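(* Let $f\in\mathbb{Z}[x_1,\dots,x_n]$ be a polynomial of degree $d\ge1$ whose real zero set is smooth, and let $I\subseteq\mathbb{R}^n$ be an axis-aligned $n$-dimensional cube whose corners have integral coordinates. Let $H$ be the maximum absolute value of the coefficients of $f$ and of the coordinates of the corners of $I$. The number of (terminal) regions produced by the modified Plantinga–Vegter (PV) algorithm on input $(f,I)$ is $$2^{O\left(n^3\,2^{24n}\,d^{12n+1}\,(d+\lg H+n\lg d)\right)}.$$
   Context: $\lg=\log_2$. The real zero set of $f$ is smooth if there is no $x\in\mathbb{R}^n$ with $f(x)=0$ and $\nabla f(x)=0$. Standard centered form: for a polynomial $F\in\mathbb{R}[z_1,\dots,z_N]$ of total degree $D$ and an axis-aligned $N$-dimensional cube $Q$ (product of $N$ closed intervals of common width $w>0$) with midpoint $m$, $$\square F(Q)=F(m)+\left(\sum_{1\le|\alpha|\le D}\frac{|\partial^\alpha F(m)|}{\alpha!}\left(\frac{w}{2}\right)^{|\alpha|}\right)[-1,1].$$ Tests: let $g(x_1,\dots,x_n,y_1,\dots,y_n)=\langle\nabla f(x_1,\dots,x_n),\nabla f(y_1,\dots,y_n)\rangle=\sum_{i=1}^n\partial_i f(x)\,\partial_i f(y)$. For an axis-aligned cube $J\subseteq\mathbb{R}^n$: $C_0(J)$ is True iff $0\notin\square f(J)$; $C_1(J)$ is True iff $0\notin\square g(J\times J)$. Modified PV algorithm (main subdivision): start with $P=\{I\}$; as long as some $J\in P$ satisfies neither $C_0(J)$ nor $C_1(J)$, replace $J$ in $P$ by the $2^n$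 congruent subcubes obtained by bisecting each side of $J$. The terminal regions are the elements of the final $P$. *)

theory Defs
  imports "HOL-Analysis.Analysis" "HOL-Library.Poly_Mapping"
begin

text \<open>
  A multi-index (exponent vector) is a finitely supported map from variable indices to
  exponents, and a polynomial is a finitely supported map from multi-indices to coefficients,
  with the convolution product of \<^theory>\<open>HOL-Library.Poly_Mapping\<close>.
  The number of variables is not part of the type: a polynomial in \<open>x\<^sub>1, \<dots>, x\<^sub>n\<close> is one
  whose variables have indices in \<open>{..<n}\<close>.
\<close>

type_synonym mindex = "nat \<Rightarrow>\<^sub>0 nat"
type_synonym 'a mpoly = "mindex \<Rightarrow>\<^sub>0 'a"

definition mdeg :: "mindex \<Rightarrow> nat" where
  "mdeg \<alpha> = (\<Sum>i\<in>Poly_Mapping.keys \<alpha>. Poly_Mapping.lookup \<alpha> i)"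

definition mfact :: "mindex \<Rightarrow> nat" where
  "mfact \<alpha> = (\<Prod>i\<in>Poly_Mapping.keys \<alpha>. fact (Poly_Mapping.lookup \<alpha> i))"

definition vars :: "'a::zero mpoly \<Rightarrow> nat set" where
  "vars p = (\<Union>\<alpha>\<in>Poly_Mapping.keys p. Poly_Mapping.keys \<alpha>)"

definition total_degree :: "'a::zero mpoly \<Rightarrow> nat" where
  "total_degree p = Max (insert 0 (mdeg ` Poly_Mapping.keys p))"

definition mpeval :: "'a::comm_semiring_1 mpoly \<Rightarrow> (nat \<Rightarrow> 'a) \<Rightarrow> 'a" where
  "mpeval p x = (\<Sum>\<alpha>\<in>Poly_Mapping.keys p.
     Poly_Mapping.lookup p \<alpha> * (\<Prod>i\<in>Poly_Mapping.keys \<alpha>. x i ^ Poly_Mapping.lookup \<alpha> i))"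

definition pdiff :: "nat \<Rightarrow> 'a::comm_semiring_1 mpoly \<Rightarrow> 'a mpoly" where
  "pdiff i p = (\<Sum>\<alpha>\<in>Poly_Mapping.keys p.
     Poly_Mapping.single (\<alpha> - Poly_Mapping.single i 1) (of_nat (Poly_Mapping.lookup \<alpha> i) * Poly_Mapping.lookup p \<alpha>))"

text \<open>\<open>\<partial>\<^sup>\<alpha> p\<close>, for \<open>\<alpha>\<close> supported in \<open>{..<N}\<close>.\<close>

definition mdiff :: "nat \<Rightarrow> mindex \<Rightarrow> 'a::comm_semiring_1 mpoly \<Rightarrow> 'a mpoly" where
  "mdiff N \<alpha> p = foldr (\<lambda>i. pdiff i ^^ Poly_Mapping.lookup \<alpha> i) [0..<N] p"

text \<open>\<open>shift_vars k p\<close> substitutes the variable with index \<open>i + k\<close> for the one with index \<open>i\<close>.\<close>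

definition shift_mindex :: "nat \<Rightarrow> mindex \<Rightarrow> mindex" where
  "shift_mindex k \<alpha> = (\<Sum>i\<in>Poly_Mapping.keys \<alpha>. Poly_Mapping.single (i + k) (Poly_Mapping.lookup \<alpha> i))"

definition shift_vars :: "nat \<Rightarrow> 'a::comm_semiring_1 mpoly \<Rightarrow> 'a mpoly" where
  "shift_vars k p = (\<Sum>\<alpha>\<in>Poly_Mapping.keys p.
     Poly_Mapping.single (shift_mindex k \<alpha>) (Poly_Mapping.lookup p \<alpha>))"

definition real_poly :: "int mpoly \<Rightarrow> real mpoly" where
  "real_poly p = Poly_Mapping.map real_of_int p"

text \<open>Only the first \<open>n\<close> values of \<open>x\<close> matter when the variables of \<open>p\<close> lie in \<open>{..<n}\<close>.\<close>

definition smooth_zero_set :: "nat \<Rightarrow> real mpoly \<Rightarrow> bool" where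
  "smooth_zero_set n p \<longleftrightarrow>
     \<not> (\<exists>x :: nat \<Rightarrow> real. mpeval p x = 0 \<and> (\<forall>i<n. mpeval (pdiff i p) x = 0))"

text \<open>
  \<open>Cube a w\<close> stands for the product of the intervals \<open>[a ! i, a ! i + w]\<close>, \<open>i < length a\<close>.
  For \<open>w > 0\<close> and \<open>a \<noteq> []\<close>, distinct pairs \<open>(a, w)\<close> give distinct cubes.
\<close>

datatype cube = Cube (lower: "real list") (width: real)

definition is_cube :: "nat \<Rightarrow> cube \<Rightarrow> bool" where
  "is_cube n J \<longleftrightarrow> length (lower J) = n \<and> width J > 0"

definition corners :: "cube \<Rightarrow> real list set" where
  "corners J = {c. length c = length (lower J) \<and>
     (\<forall>i<length c. c ! i = lower J ! i \<or> c ! i = lower J ! i + width J)}"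

definition cube_midpoint :: "cube \<Rightarrow> real list" where
  "cube_midpoint J = map (\<lambda>a. a + width J / 2) (lower J)"

definition subcubes :: "cube \<Rightarrow> cube set" where
  "subcubes J = {Cube b (width J / 2) | b. length b = length (lower J) \<and>
     (\<forall>i<length b. b ! i = lower J ! i \<or> b ! i = lower J ! i + width J / 2)}"

definition cube_square :: "cube \<Rightarrow> cube" where
  "cube_square J = Cube (lower J @ lower J) (width J)"

text \<open>The standard centered form, in \<open>N = length (lower Q)\<close> variables.\<close>

definition centered_form :: "real mpoly \<Rightarrow> cube \<Rightarrow> real set" where
  "centered_form F Q =
     (let N = length (lower Q); x = (\<lambda>i. cube_midpoint Q ! i);
          R = (\<Sum>\<alpha> | Poly_Mapping.keys \<alpha> \<subseteq> {..<N} \<and> 1 \<le> mdeg \<alpha> \<and> mdeg \<alpha> \<le> total_degree F.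
                 \<bar>mpeval (mdiff N \<alpha> F) x\<bar> / real (mfact \<alpha>) * (width Q / 2) ^ mdeg \<alpha>)
      in (\<lambda>t. mpeval F x + R * t) ` {-1..1})"

text \<open>\<open>\<langle>\<nabla>f(x), \<nabla>f(y)\<rangle>\<close>, where \<open>x\<close> has indices \<open>0, \<dots>, n - 1\<close> and \<open>y\<close> has indices \<open>n, \<dots>, 2n - 1\<close>.\<close>

definition grad_product :: "nat \<Rightarrow> real mpoly \<Rightarrow> real mpoly" where
  "grad_product n f = (\<Sum>i<n. pdiff i f * shift_vars n (pdiff i f))"

definition C0 :: "real mpoly \<Rightarrow> cube \<Rightarrow> bool" where
  "C0 f J \<longleftrightarrow> 0 \<notin> centered_form f J"

definition C1 :: "nat \<Rightarrow> real mpoly \<Rightarrow> cube \<Rightarrow> bool" where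
  "C1 n f J \<longleftrightarrow> 0 \<notin> centered_form (grad_product n f) (cube_square J)"

definition pv_step :: "nat \<Rightarrow> real mpoly \<Rightarrow> cube set \<Rightarrow> cube set \<Rightarrow> bool" where
  "pv_step n f P P' \<longleftrightarrow>
     (\<exists>J\<in>P. \<not> C0 f J \<and> \<not> C1 n f J \<and> P' = (P - {J}) \<union> subcubes J)"

text \<open>
  The order in which cubes are processed is left open: termination means that no sequence of
  choices runs forever, and the possible outputs are all partitions at which a run can stop.
\<close>

definition pv_terminates :: "nat \<Rightarrow> real mpoly \<Rightarrow> cube \<Rightarrow> bool" where
  "pv_terminates n f I \<longleftrightarrow>
     \<not> (\<exists>P :: nat \<Rightarrow> cube set. P 0 = {I} \<and> (\<forall>k. pv_step n f (P k) (P (Suc k))))"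

definition pv_output :: "nat \<Rightarrow> real mpoly \<Rightarrow> cube \<Rightarrow> cube set \<Rightarrow> bool" where
  "pv_output n f I P \<longleftrightarrow> (pv_step n f)\<^sup>*\<^sup>* {I} P \<and> (\<forall>J\<in>P. C0 f J \<or> C1 n f J)"

definition input_height :: "int mpoly \<Rightarrow> cube \<Rightarrow> real" where
  "input_height f I = Max
     ({\<bar>real_of_int (Poly_Mapping.lookup f \<alpha>)\<bar> | \<alpha>. \<alpha> \<in> Poly_Mapping.keys f} \<union>
      {\<bar>c ! i\<bar> | c i. c \<in> corners I \<and> i < length c})"

end

theory Submission
  imports Defs "Jordan_Normal_Form.Char_Poly"
begin

text \<open>
  Put \<open>G = f\<^sup>2 + |\<nabla>f|\<^sup>2\<close>. If both tests fail on a cube of width \<open>w \<le> 2\<close> with midpoint \<open>p\<close>, then \<open>|f(p)|\<close> and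
  \<open>|\<nabla>f(p)|\<^sup>2\<close> are at most \<open>w\<close> times an explicit constant, so \<open>w\<close> is bounded below in terms of
  \<open>\<mu> = min G\<close> over \<open>I\<close>, and a volume argument bounds the number of regions.

  Smoothness gives \<open>\<mu> > 0\<close>. To bound \<open>\<mu>\<close> from below, minimise \<open>s G(x) + \<Sum> x\<^sub>i\<^sup>m / m\<close> over the box for large
  real \<open>s\<close>, where \<open>m = deg G + 2\<close>. At a minimiser, every \<open>x\<^sub>i\<^sup>m\<^sup>+\<^sup>1\<close> is a polynomial of smaller total degree with
  coefficients in \<open>\<int>[s]\<close>, so every monomial reduces to those with all exponents at most \<open>m\<close>. Hence \<open>G(x)\<close> is an
  eigenvalue of a matrix over \<open>\<int>[s]\<close> of size \<open>(m + 1)\<^sup>n\<close>. As \<open>s \<rightarrow> \<infinity>\<close> the eigenvalue tends to \<open>\<mu>\<close>, which is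
  therefore a root of the leading coefficient, with respect to \<open>s\<close>, of the characteristic polynomial. This is a
  nonzero integer polynomial with bounded coefficients, and its positive roots cannot be too small.
\<close>

text \<open>The critical points of \<open>G\<close> on the box need not be isolated, so eliminating
  variables from their equations could end in the zero polynomial. The penalty removes this
  obstacle: each critical equation becomes monic in the pure power \<open>x i ^ (m + 1)\<close>, so
  reduction never divides and its coefficients stay in Z[s]. This is why the large parameter
  multiplies \<open>G\<close>: a small factor on the penalty would instead sit on the leading
  monomial. The price is that the minimiser moves with \<open>s\<close>; passing to the leading
  coefficient in \<open>s\<close> undoes this. The determinant is nonzero because at
  \<open>s = 0\<close> it is the monic characteristic polynomial of an integer matrix.

  Sizes are measured by l1 norms, which behave well under sums and products. The matrix size, at
  most \<open>(2 * d + 3) ^ n\<close>, is the dominant factor in the logarithm of the bound for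
  1/\<mu>. With X = d + lg H + n lg d, the argument gives an exponent of order n^3 (2d+3)^n d X; the
  numbers 24 and 12 of the theorem enter only when \<open>2 * d + 3\<close> is estimated at the
  end.\<close>

abbreviation keys :: "('a \<Rightarrow>\<^sub>0 'b::zero) \<Rightarrow> 'a set" where "keys \<equiv> Poly_Mapping.keys"
abbreviation lookup :: "('a \<Rightarrow>\<^sub>0 'b::zero) \<Rightarrow> 'a \<Rightarrow> 'b" where "lookup \<equiv> Poly_Mapping.lookup"
abbreviation single :: "'a \<Rightarrow> 'b \<Rightarrow> 'a \<Rightarrow>\<^sub>0 'b::zero" where "single \<equiv> Poly_Mapping.single"

section \<open>Polynomials as finitely supported maps: evaluation, degree, l1 norm,
  derivatives\<close>

subsection \<open>Monomials and evaluation\<close>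

definition meval :: "(nat \<Rightarrow> 'a::comm_semiring_1) \<Rightarrow> mindex \<Rightarrow> 'a" where
  "meval x \<alpha> = (\<Prod>i\<in>keys \<alpha>. x i ^ lookup \<alpha> i)"

lemma meval_superset:
  assumes "finite S" "keys \<alpha> \<subseteq> S"
  shows "meval x \<alpha> = (\<Prod>i\<in>S. x i ^ lookup \<alpha> i)"
  unfolding meval_def by (rule prod.mono_neutral_left) (use assms in \<open>auto simp: in_keys_iff\<close>)

lemma meval_add: "meval x (\<alpha> + \<beta>) = meval x \<alpha> * meval x \<beta>"
proof -
  let ?S = "keys \<alpha> \<union> keys \<beta>"
  have "meval x (\<alpha> + \<beta>) = (\<Prod>i\<in>?S. x i ^ lookup (\<alpha> + \<beta>) i)"
    by (intro meval_superset) (use keys_add[of \<alpha> \<beta>] in auto)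
  also have "\<dots> = meval x \<alpha> * meval x \<beta>"
    by (simp add: meval_superset[of ?S \<alpha>] meval_superset[of ?S \<beta>] lookup_add power_add prod.distrib)
  finally show ?thesis .
qed

lemma meval_single [simp]: "meval x (single i k) = x i ^ k"
  by (cases "k = 0") (auto simp: meval_def)

lemma meval_zero [simp]: "meval x 0 = 1"
  by (simp add: meval_def)

lemma mdeg_superset:
  assumes "finite S" "keys \<alpha> \<subseteq> S"
  shows "mdeg \<alpha> = (\<Sum>i\<in>S. lookup \<alpha> i)"
  unfolding mdeg_def by (rule sum.mono_neutral_left) (use assms in \<open>auto simp: in_keys_iff\<close>)

lemma mdeg_add: "mdeg (\<alpha> + \<beta>) = mdeg \<alpha> + mdeg \<beta>"
proof -
  let ?S = "keys \<alpha> \<union> keys \<beta>"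
  have "mdeg (\<alpha> + \<beta>) = (\<Sum>i\<in>?S. lookup (\<alpha> + \<beta>) i)"
    by (intro mdeg_superset) (use keys_add[of \<alpha> \<beta>] in auto)
  also have "\<dots> = mdeg \<alpha> + mdeg \<beta>"
    by (simp add: mdeg_superset[of ?S \<alpha>] mdeg_superset[of ?S \<beta>] lookup_add sum.distrib)
  finally show ?thesis .
qed

lemma mdeg_single [simp]: "mdeg (single i k) = k"
  by (cases "k = 0") (auto simp: mdeg_def)

lemma mdeg_zero [simp]: "mdeg 0 = 0"
  by (simp add: mdeg_def)

lemma lookup_le_mdeg: "lookup \<alpha> i \<le> mdeg \<alpha>"
  by (cases "i \<in> keys \<alpha>") (auto simp: mdeg_def in_keys_iff intro: member_le_sum)

lemma mindex_split:
  fixes \<alpha> :: mindex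
  assumes "k \<le> lookup \<alpha> i"
  shows "\<alpha> = single i k + (\<alpha> - single i k)"
  by (rule poly_mapping_eqI) (use assms in \<open>auto simp: lookup_add lookup_minus lookup_single when_def\<close>)

lemma mdeg_minus_le: "mdeg (\<alpha> - \<beta>) \<le> mdeg \<alpha>"
proof -
  have k: "keys (\<alpha> - \<beta>) \<subseteq> keys \<alpha>"
    by (auto simp: in_keys_iff lookup_minus)
  show ?thesis
    unfolding mdeg_superset[OF finite_keys k] mdeg_def[of \<alpha>]
    by (rule sum_mono) (simp add: lookup_minus)
qed

lemma mpoly_expand: "p = (\<Sum>\<alpha>\<in>keys p. single \<alpha> (lookup p \<alpha>))"
proof (rule poly_mapping_eqI)
  fix \<beta>
  have "lookup (\<Sum>\<alpha>\<in>keys p. single \<alpha> (lookup p \<alpha>)) \<beta> = (\<Sum>\<alpha>\<in>keys p. if \<alpha> = \<beta> then lookup p \<beta> else 0)"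
    unfolding lookup_sum by (rule sum.cong) (auto simp: lookup_single when_def)
  also have "\<dots> = lookup p \<beta>"
    by (simp add: in_keys_iff)
  finally show "lookup p \<beta> = lookup (\<Sum>\<alpha>\<in>keys p. single \<alpha> (lookup p \<alpha>)) \<beta>" by simp
qed

lemma mpoly_mult_expand:
  fixes p q :: "'a::comm_semiring_1 mpoly"
  shows "p * q = (\<Sum>\<alpha>\<in>keys p. \<Sum>\<beta>\<in>keys q. single (\<alpha> + \<beta>) (lookup p \<alpha> * lookup q \<beta>))"
  by (subst mpoly_expand[of p], subst mpoly_expand[of q])
     (simp add: sum_product mult_single)

lemma mpeval_superset:
  assumes "finite S" "keys p \<subseteq> S"
  shows "mpeval p x = (\<Sum>\<alpha>\<in>S. lookup p \<alpha> * meval x \<alpha>)"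
  unfolding mpeval_def meval_def by (rule sum.mono_neutral_left) (use assms in \<open>auto simp: in_keys_iff\<close>)

lemma mpeval_meval: "mpeval p x = (\<Sum>\<alpha>\<in>keys p. lookup p \<alpha> * meval x \<alpha>)"
  by (simp add: mpeval_def meval_def)

lemma mpeval_zero [simp]: "mpeval 0 x = 0"
  by (simp add: mpeval_def)

lemma mpeval_single [simp]: "mpeval (single \<alpha> c) x = c * meval x \<alpha>"
  by (cases "c = 0") (auto simp: mpeval_meval)

lemma mpeval_add [simp]: "mpeval (p + q) x = mpeval p x + mpeval q x"
proof -
  let ?S = "keys p \<union> keys q"
  have "mpeval (p + q) x = (\<Sum>\<alpha>\<in>?S. lookup (p + q) \<alpha> * meval x \<alpha>)"
    by (intro mpeval_superset) (use keys_add[of p q] in auto)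
  also have "\<dots> = mpeval p x + mpeval q x"
    by (simp add: mpeval_superset[of ?S p] mpeval_superset[of ?S q] lookup_add distrib_right sum.distrib)
  finally show ?thesis .
qed

lemma mpeval_sum [simp]: "mpeval (\<Sum>j\<in>S. p j) x = (\<Sum>j\<in>S. mpeval (p j) x)"
  by (induction S rule: infinite_finite_induct) auto

lemma mpeval_mult [simp]: "mpeval (p * q) x = mpeval p x * mpeval q x"
  unfolding mpoly_mult_expand mpeval_sum mpeval_single meval_add
  by (simp add: mpeval_meval sum_product mult_ac)

lemma mpeval_uminus [simp]: "mpeval (- p) x = - mpeval p x" for p :: "'a::comm_ring_1 mpoly"
  using mpeval_add[of p "- p" x] by (simp add: add_eq_0_iff)

lemma mpeval_cong:
  assumes "\<And>i. i \<in> vars p \<Longrightarrow> x i = y i"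
  shows "mpeval p x = mpeval p y"
  unfolding mpeval_def
  by (intro sum.cong prod.cong refl arg_cong2[where f="(*)"] arg_cong2[where f="(^)"] assms)
     (auto simp: vars_def)

subsection \<open>Degree, variables, norm and integrality\<close>

lemma total_degree_le_iff: "total_degree p \<le> D \<longleftrightarrow> (\<forall>\<alpha>\<in>keys p. mdeg \<alpha> \<le> D)"
  unfolding total_degree_def by (subst Max_le_iff) auto

lemma mdeg_le_total_degree: "\<alpha> \<in> keys p \<Longrightarrow> mdeg \<alpha> \<le> total_degree p"
  using total_degree_le_iff by blast

lemma keys_sum_subset: "keys (\<Sum>j\<in>S. p j) \<subseteq> (\<Union>j\<in>S. keys (p j))"
proof (induction S rule: infinite_finite_induct)
  case (insert j S)
  then show ?case using keys_add[of "p j" "\<Sum>j\<in>S. p j"] by auto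
qed auto

lemma total_degree_add_le:
  "total_degree p \<le> D \<Longrightarrow> total_degree q \<le> D \<Longrightarrow> total_degree (p + q) \<le> D"
  unfolding total_degree_le_iff using keys_add[of p q] by blast

lemma total_degree_sum_le:
  "(\<And>j. j \<in> S \<Longrightarrow> total_degree (p j) \<le> D) \<Longrightarrow> total_degree (\<Sum>j\<in>S. p j) \<le> D"
  unfolding total_degree_le_iff using keys_sum_subset[of p S] by blast

lemma total_degree_mult_le:
  assumes "total_degree p \<le> D" "total_degree q \<le> E"
  shows "total_degree (p * q) \<le> D + E"
  unfolding total_degree_le_iff
proof
  fix \<gamma> assume "\<gamma> \<in> keys (p * q)"
  with keys_mult[of p q] obtain \<alpha> \<beta> where "\<gamma> = \<alpha> + \<beta>" "\<alpha> \<in> keys p" "\<beta> \<in> keys q" by blast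
  with assms show "mdeg \<gamma> \<le> D + E"
    unfolding total_degree_le_iff by (simp add: mdeg_add add_mono)
qed

lemma total_degree_single_le: "mdeg \<alpha> \<le> D \<Longrightarrow> total_degree (single \<alpha> c) \<le> D"
  by (auto simp: total_degree_le_iff)

lemma total_degree_uminus [simp]: "total_degree (- p) = total_degree p" for p :: "'a::ab_group_add mpoly"
proof -
  have "keys (- p) = keys p" by (auto simp: in_keys_iff)
  then show ?thesis by (simp add: total_degree_def)
qed

lemma vars_sum_subset: "(\<And>j. j \<in> S \<Longrightarrow> vars (p j) \<subseteq> V) \<Longrightarrow> vars (\<Sum>j\<in>S. p j) \<subseteq> V"
  unfolding vars_def using keys_sum_subset[of p S] by blast

lemma vars_add_subset: "vars p \<subseteq> V \<Longrightarrow> vars q \<subseteq> V \<Longrightarrow> vars (p + q) \<subseteq> V"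
  unfolding vars_def using keys_add[of p q] by blast

lemma vars_mult_subset:
  assumes "vars p \<subseteq> V" "vars q \<subseteq> V"
  shows "vars (p * q) \<subseteq> V"
proof
  fix i assume "i \<in> vars (p * q)"
  then obtain \<alpha> \<beta> where "\<alpha> \<in> keys p" "\<beta> \<in> keys q" "i \<in> keys (\<alpha> + \<beta>)"
    using keys_mult[of p q] unfolding vars_def by blast
  with keys_add[of \<alpha> \<beta>] assms show "i \<in> V" unfolding vars_def by blast
qed

lemma vars_single_subset: "keys \<alpha> \<subseteq> V \<Longrightarrow> vars (single \<alpha> c) \<subseteq> V"
  by (auto simp: vars_def split: if_splits)

lemma vars_uminus [simp]: "vars (- p) = vars p" for p :: "'a::ab_group_add mpoly"
proof -
  have "keys (- p) = keys p" by (auto simp: in_keys_iff)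
  then show ?thesis by (simp add: vars_def)
qed

text \<open>Subadditive and submultiplicative, so bounds pass through sums, products and derivatives
  term by term; together with the degree it bounds the values on a box.\<close>

definition l1_norm :: "real mpoly \<Rightarrow> real" where
  "l1_norm p = (\<Sum>\<alpha>\<in>keys p. \<bar>lookup p \<alpha>\<bar>)"

lemma l1_norm_superset:
  assumes "finite S" "keys p \<subseteq> S"
  shows "l1_norm p = (\<Sum>\<alpha>\<in>S. \<bar>lookup p \<alpha>\<bar>)"
  unfolding l1_norm_def by (rule sum.mono_neutral_left) (use assms in \<open>auto simp: in_keys_iff\<close>)

lemma l1_norm_nonneg [simp]: "0 \<le> l1_norm p"
  by (simp add: l1_norm_def sum_nonneg)

lemma l1_norm_zero [simp]: "l1_norm 0 = 0"
  by (simp add: l1_norm_def)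

lemma l1_norm_single [simp]: "l1_norm (single \<alpha> c) = \<bar>c\<bar>"
  by (cases "c = 0") (auto simp: l1_norm_def)

lemma l1_norm_uminus [simp]: "l1_norm (- p) = l1_norm p"
proof -
  have "keys (- p) = keys p" by (auto simp: in_keys_iff)
  then show ?thesis by (simp add: l1_norm_def)
qed

lemma l1_norm_add: "l1_norm (p + q) \<le> l1_norm p + l1_norm q"
proof -
  let ?S = "keys p \<union> keys q"
  have "l1_norm (p + q) = (\<Sum>\<alpha>\<in>?S. \<bar>lookup (p + q) \<alpha>\<bar>)"
    by (intro l1_norm_superset) (use keys_add[of p q] in auto)
  also have "\<dots> \<le> (\<Sum>\<alpha>\<in>?S. \<bar>lookup p \<alpha>\<bar> + \<bar>lookup q \<alpha>\<bar>)"
    by (intro sum_mono) (simp add: lookup_add)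
  also have "\<dots> = l1_norm p + l1_norm q"
    by (simp add: l1_norm_superset[of ?S p] l1_norm_superset[of ?S q] sum.distrib)
  finally show ?thesis .
qed

lemma l1_norm_sum: "l1_norm (\<Sum>j\<in>S. p j) \<le> (\<Sum>j\<in>S. l1_norm (p j))"
proof (induction S rule: infinite_finite_induct)
  case (insert j S)
  then show ?case using l1_norm_add[of "p j" "\<Sum>j\<in>S. p j"] by auto
qed auto

lemma l1_norm_mult: "l1_norm (p * q) \<le> l1_norm p * l1_norm q"
proof -
  have "l1_norm (p * q) \<le> (\<Sum>\<alpha>\<in>keys p. \<Sum>\<beta>\<in>keys q. l1_norm (single (\<alpha> + \<beta>) (lookup p \<alpha> * lookup q \<beta>)))"
    unfolding mpoly_mult_expand by (intro order.trans[OF l1_norm_sum] sum_mono l1_norm_sum)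
  also have "\<dots> = l1_norm p * l1_norm q"
    unfolding l1_norm_single by (simp add: l1_norm_def sum_product abs_mult)
  finally show ?thesis .
qed

lemma abs_meval_le:
  fixes x :: "nat \<Rightarrow> real"
  assumes "\<And>i. i \<in> keys \<alpha> \<Longrightarrow> \<bar>x i\<bar> \<le> B"
  shows "\<bar>meval x \<alpha>\<bar> \<le> B ^ mdeg \<alpha>"
proof -
  have "\<bar>meval x \<alpha>\<bar> = (\<Prod>i\<in>keys \<alpha>. \<bar>x i\<bar> ^ lookup \<alpha> i)"
    by (simp add: meval_def abs_prod power_abs)
  also have "\<dots> \<le> (\<Prod>i\<in>keys \<alpha>. B ^ lookup \<alpha> i)"
    by (intro prod_mono) (use assms in \<open>auto intro: power_mono\<close>)
  also have "\<dots> = B ^ mdeg \<alpha>" by (simp add: mdeg_def power_sum)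
  finally show ?thesis .
qed

lemma abs_mpeval_le:
  fixes x :: "nat \<Rightarrow> real"
  assumes "vars p \<subseteq> V" "\<And>i. i \<in> V \<Longrightarrow> \<bar>x i\<bar> \<le> B" "1 \<le> B" "total_degree p \<le> D"
  shows "\<bar>mpeval p x\<bar> \<le> l1_norm p * B ^ D"
proof -
  have "\<bar>mpeval p x\<bar> \<le> (\<Sum>\<alpha>\<in>keys p. \<bar>lookup p \<alpha>\<bar> * \<bar>meval x \<alpha>\<bar>)"
    unfolding mpeval_meval by (rule order.trans[OF sum_abs]) (simp add: abs_mult)
  also have "\<dots> \<le> (\<Sum>\<alpha>\<in>keys p. \<bar>lookup p \<alpha>\<bar> * B ^ D)"
  proof (intro sum_mono mult_left_mono)
    fix \<alpha> assume a: "\<alpha> \<in> keys p"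
    have "\<bar>meval x \<alpha>\<bar> \<le> B ^ mdeg \<alpha>"
      using assms(1,2) a by (intro abs_meval_le) (auto simp: vars_def)
    also have "\<dots> \<le> B ^ D"
      using assms(3,4) a by (intro power_increasing) (auto simp: total_degree_le_iff)
    finally show "\<bar>meval x \<alpha>\<bar> \<le> B ^ D" .
  qed auto
  also have "\<dots> = l1_norm p * B ^ D" by (simp add: l1_norm_def sum_distrib_right)
  finally show ?thesis .
qed

text \<open>Integrality is a predicate on real polynomials because derivatives, values and norms are
  all taken over the reals. The integers are recovered with floors when elements of
  \<open>int poly\<close> are built from the coefficients.\<close>

definition int_coeffs :: "real mpoly \<Rightarrow> bool" where
  "int_coeffs p \<longleftrightarrow> (\<forall>\<alpha>. lookup p \<alpha> \<in> \<int>)"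

lemma int_coeffs_add: "int_coeffs p \<Longrightarrow> int_coeffs q \<Longrightarrow> int_coeffs (p + q)"
  by (simp add: int_coeffs_def lookup_add)

lemma int_coeffs_uminus: "int_coeffs p \<Longrightarrow> int_coeffs (- p)"
  by (simp add: int_coeffs_def)

lemma int_coeffs_sum: "(\<And>j. j \<in> S \<Longrightarrow> int_coeffs (p j)) \<Longrightarrow> int_coeffs (\<Sum>j\<in>S. p j)"
  unfolding int_coeffs_def lookup_sum by (intro allI Ints_sum) blast

lemma int_coeffs_single: "c \<in> \<int> \<Longrightarrow> int_coeffs (single \<alpha> c)"
  by (simp add: int_coeffs_def lookup_single when_def)

lemma int_coeffs_mult: "int_coeffs p \<Longrightarrow> int_coeffs q \<Longrightarrow> int_coeffs (p * q)"
  unfolding mpoly_mult_expand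
  by (intro int_coeffs_sum int_coeffs_single) (auto simp: int_coeffs_def)

subsection \<open>Partial derivatives\<close>

lemma total_degree_pdiff_le: "total_degree (pdiff i p) \<le> total_degree p"
  unfolding pdiff_def
  by (intro total_degree_sum_le total_degree_single_le)
     (meson mdeg_minus_le mdeg_le_total_degree order.trans)

lemma keys_minus_subset: "keys (\<alpha> - \<beta>) \<subseteq> keys \<alpha>" for \<alpha> :: mindex
  by (auto simp: in_keys_iff lookup_minus)

lemma vars_pdiff_subset: "vars p \<subseteq> V \<Longrightarrow> vars (pdiff i p) \<subseteq> V"
  unfolding pdiff_def
  by (intro vars_sum_subset vars_single_subset order.trans[OF keys_minus_subset])
     (auto simp: vars_def)

lemma int_coeffs_pdiff: "int_coeffs p \<Longrightarrow> int_coeffs (pdiff i p)"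
  unfolding pdiff_def
  by (intro int_coeffs_sum int_coeffs_single) (auto simp: int_coeffs_def)

lemma l1_norm_pdiff_le:
  assumes "total_degree p \<le> D"
  shows "l1_norm (pdiff i p) \<le> real D * l1_norm p"
proof -
  have "l1_norm (pdiff i p) \<le> (\<Sum>\<alpha>\<in>keys p. real (lookup \<alpha> i) * \<bar>lookup p \<alpha>\<bar>)"
    unfolding pdiff_def by (rule order.trans[OF l1_norm_sum]) (simp add: abs_mult)
  also have "\<dots> \<le> (\<Sum>\<alpha>\<in>keys p. real D * \<bar>lookup p \<alpha>\<bar>)"
  proof (intro sum_mono mult_right_mono)
    fix \<alpha> assume "\<alpha> \<in> keys p"
    then show "real (lookup \<alpha> i) \<le> real D"
      using assms lookup_le_mdeg[of \<alpha> i] mdeg_le_total_degree[of \<alpha> p] by linarith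
  qed auto
  finally show ?thesis by (simp add: l1_norm_def sum_distrib_left)
qed

lemma meval_fun_upd:
  fixes x :: "nat \<Rightarrow> real"
  shows "meval (x(i := t)) \<alpha> = t ^ lookup \<alpha> i * (\<Prod>j\<in>keys \<alpha> - {i}. x j ^ lookup \<alpha> j)"
proof -
  let ?S = "insert i (keys \<alpha>)"
  have "meval (x(i := t)) \<alpha> = (\<Prod>j\<in>?S. (x(i := t)) j ^ lookup \<alpha> j)"
    by (rule meval_superset) auto
  also have "\<dots> = (x(i := t)) i ^ lookup \<alpha> i * (\<Prod>j\<in>?S - {i}. (x(i := t)) j ^ lookup \<alpha> j)"
    by (rule prod.remove) auto
  also have "(\<Prod>j\<in>?S - {i}. (x(i := t)) j ^ lookup \<alpha> j) = (\<Prod>j\<in>keys \<alpha> - {i}. x j ^ lookup \<alpha> j)"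
    by (rule prod.cong) auto
  finally show ?thesis by (simp only: fun_upd_same)
qed

text \<open>Links the formal \<open>pdiff\<close> to analysis along a coordinate line, which is how
  the minimality of a point is turned into a polynomial equation.\<close>

lemma has_real_derivative_mpeval:
  fixes x :: "nat \<Rightarrow> real"
  shows "((\<lambda>t. mpeval p (x(i := t))) has_real_derivative mpeval (pdiff i p) (x(i := t))) (at t)"
proof -
  \<comment> \<open>If the exponent of \<open>i\<close> is 0, truncated subtraction leaves \<alpha>
    unchanged, but then the factor \<open>lookup \<alpha> i\<close> makes the term vanish.\<close>
  have *: "((\<lambda>t. lookup p \<alpha> * meval (x(i := t)) \<alpha>) has_real_derivative
      real (lookup \<alpha> i) * lookup p \<alpha> * meval (x(i := t)) (\<alpha> - single i 1)) (at t)" for \<alpha>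
  proof -
    let ?c = "\<Prod>j\<in>keys \<alpha> - {i}. x j ^ lookup \<alpha> j"
    have k: "keys (\<alpha> - single i 1) - {i} = keys \<alpha> - {i}"
      by (auto simp: in_keys_iff lookup_minus lookup_single when_def)
    have c: "(\<Prod>j\<in>keys (\<alpha> - single i 1) - {i}. x j ^ lookup (\<alpha> - single i 1) j) = ?c"
      unfolding k by (rule prod.cong) (auto simp: lookup_minus lookup_single when_def)
    show ?thesis
      unfolding meval_fun_upd c
      by (auto intro!: derivative_eq_intros simp: lookup_minus)
  qed
  show ?thesis
    unfolding mpeval_meval[of p] pdiff_def mpeval_sum mpeval_single
    by (intro DERIV_sum *)
qed

subsection \<open>Shifted variables and the gradient product\<close>

lemma keys_shift_mindex: "keys (shift_mindex k \<alpha>) \<subseteq> (\<lambda>i. i + k) ` keys \<alpha>"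
  unfolding shift_mindex_def
  by (rule order.trans[OF keys_sum_subset]) auto

lemma mdeg_sum: "mdeg (\<Sum>j\<in>S. f j) = (\<Sum>j\<in>S. mdeg (f j))"
  by (induction S rule: infinite_finite_induct) (auto simp: mdeg_add)

lemma meval_sum: "meval x (\<Sum>j\<in>S. f j) = (\<Prod>j\<in>S. meval x (f j))"
  by (induction S rule: infinite_finite_induct) (auto simp: meval_add)

lemma mdeg_shift_mindex: "mdeg (shift_mindex k \<alpha>) = mdeg \<alpha>"
  by (simp add: shift_mindex_def mdeg_sum) (simp add: mdeg_def)

lemma meval_shift_mindex: "meval x (shift_mindex k \<alpha>) = meval (\<lambda>i. x (i + k)) \<alpha>"
  by (simp add: shift_mindex_def meval_sum) (simp add: meval_def)

lemma mpeval_shift_vars: "mpeval (shift_vars k p) x = mpeval p (\<lambda>i. x (i + k))"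
  unfolding shift_vars_def mpeval_sum mpeval_single by (simp add: meval_shift_mindex mpeval_meval)

lemma total_degree_shift_vars_le: "total_degree (shift_vars k p) \<le> total_degree p"
  unfolding shift_vars_def
  by (intro total_degree_sum_le total_degree_single_le)
     (simp add: mdeg_shift_mindex mdeg_le_total_degree)

lemma vars_shift_vars_subset: "vars p \<subseteq> {..<n} \<Longrightarrow> vars (shift_vars k p) \<subseteq> {..<n + k}"
  unfolding shift_vars_def
  by (intro vars_sum_subset vars_single_subset order.trans[OF keys_shift_mindex])
     (auto simp: vars_def)

lemma l1_norm_shift_vars_le: "l1_norm (shift_vars k p) \<le> l1_norm p"
  unfolding shift_vars_def
  by (rule order.trans[OF l1_norm_sum], unfold l1_norm_single) (simp add: l1_norm_def)

lemma mpeval_grad_product: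
  "mpeval (grad_product n f) x = (\<Sum>i<n. mpeval (pdiff i f) x * mpeval (pdiff i f) (\<lambda>i. x (i + n)))"
  by (simp add: grad_product_def mpeval_shift_vars)

lemma total_degree_grad_product_le: "total_degree (grad_product n f) \<le> 2 * total_degree f"
  unfolding grad_product_def mult_2
  by (intro total_degree_sum_le total_degree_mult_le total_degree_pdiff_le
      order.trans[OF total_degree_shift_vars_le])

lemma vars_grad_product_subset:
  "vars f \<subseteq> {..<n} \<Longrightarrow> vars (grad_product n f) \<subseteq> {..<n + n}"
  unfolding grad_product_def
  by (intro vars_sum_subset vars_mult_subset vars_shift_vars_subset vars_pdiff_subset)
     auto

lemma l1_norm_grad_product_le:
  assumes "total_degree f \<le> d"
  shows "l1_norm (grad_product n f) \<le> real n * (real d * l1_norm f)\<^sup>2"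
proof -
  have "l1_norm (grad_product n f) \<le> (\<Sum>i<n. (real d * l1_norm f)\<^sup>2)"
    unfolding grad_product_def power2_eq_square
    by (intro order.trans[OF l1_norm_sum] sum_mono order.trans[OF l1_norm_mult] mult_mono
        order.trans[OF l1_norm_shift_vars_le] l1_norm_pdiff_le assms) auto
  then show ?thesis by simp
qed

text \<open>The polynomial \<open>G\<close> of the overview: an integer polynomial if
  \<open>f\<close> is one, and a sum of squares whose zeros are exactly the singular zeros of
  \<open>f\<close>.\<close>

definition grad_energy :: "nat \<Rightarrow> real mpoly \<Rightarrow> real mpoly" where
  "grad_energy n f = f * f + (\<Sum>i<n. pdiff i f * pdiff i f)"

lemma mpeval_grad_energy:
  "mpeval (grad_energy n f) x = (mpeval f x)\<^sup>2 + (\<Sum>i<n. (mpeval (pdiff i f) x)\<^sup>2)"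
  by (simp add: grad_energy_def power2_eq_square)

lemma total_degree_grad_energy_le: "total_degree (grad_energy n f) \<le> 2 * total_degree f"
  unfolding grad_energy_def mult_2
  by (intro total_degree_add_le total_degree_sum_le total_degree_mult_le total_degree_pdiff_le order.refl)

lemma vars_grad_energy_subset: "vars f \<subseteq> V \<Longrightarrow> vars (grad_energy n f) \<subseteq> V"
  unfolding grad_energy_def
  by (intro vars_add_subset vars_sum_subset vars_mult_subset vars_pdiff_subset)

lemma int_coeffs_grad_energy: "int_coeffs f \<Longrightarrow> int_coeffs (grad_energy n f)"
  unfolding grad_energy_def
  by (intro int_coeffs_add int_coeffs_sum int_coeffs_mult int_coeffs_pdiff)

lemma l1_norm_grad_energy_le:
  assumes "total_degree f \<le> d"
  shows "l1_norm (grad_energy n f) \<le> (1 + real n * (real d)\<^sup>2) * (l1_norm f)\<^sup>2"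
proof -
  have "l1_norm (grad_energy n f) \<le> l1_norm f * l1_norm f + (\<Sum>i<n. (real d * l1_norm f) * (real d * l1_norm f))"
    unfolding grad_energy_def
    by (intro order.trans[OF l1_norm_add] add_mono order.trans[OF l1_norm_sum] sum_mono
        order.trans[OF l1_norm_mult] mult_mono l1_norm_pdiff_le assms) auto
  then show ?thesis by (simp add: algebra_simps power2_eq_square)
qed

section \<open>Subdivision: failed tests make \<open>G\<close> small at the midpoint, and a minimal
  width bounds the number of regions\<close>

subsection \<open>The centered form\<close>

text \<open>Used in two roles: as a finite superset of exponents when terms are counted
  (\<open>e\<close> = degree + 1), and as the set of reduced monomials that index the eigenvalue
  matrix.\<close>

definition bounded_mindex :: "nat \<Rightarrow> nat \<Rightarrow> mindex set" where
  "bounded_mindex n e = {\<alpha>. keys \<alpha> \<subseteq> {..<n} \<and> (\<forall>i. lookup \<alpha> i < e)}"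

lemma
  shows finite_bounded_mindex [simp]: "finite (bounded_mindex N e)"
    and card_bounded_mindex_le: "card (bounded_mindex N e) \<le> e ^ N"
proof -
  let ?S = "bounded_mindex N e"
  let ?T = "PiE {..<N} (\<lambda>_. {..<e})"
  let ?f = "\<lambda>\<alpha>::mindex. restrict (lookup \<alpha>) {..<N}"
  have inj: "inj_on ?f ?S"
  proof (rule inj_onI)
    fix \<alpha> \<beta> :: mindex assume a: "\<alpha> \<in> ?S" "\<beta> \<in> ?S" "?f \<alpha> = ?f \<beta>"
    show "\<alpha> = \<beta>"
    proof (rule poly_mapping_eqI)
      fix i
      show "lookup \<alpha> i = lookup \<beta> i"
      proof (cases "i < N")
        case True
        then show ?thesis using fun_cong[OF a(3), of i] by simp
      next
        case False
        then have "i \<notin> keys \<alpha>" "i \<notin> keys \<beta>" using a by (auto simp: bounded_mindex_def)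
        then show ?thesis by (simp add: in_keys_iff)
      qed
    qed
  qed
  have sub: "?f ` ?S \<subseteq> ?T" by (auto simp: bounded_mindex_def PiE_def extensional_def)
  have fin: "finite ?T" by (intro finite_PiE) auto
  show "finite ?S" by (rule inj_on_finite[OF inj sub fin])
  have "card ?S \<le> card ?T" by (rule card_inj_on_le[OF inj sub fin])
  then show "card ?S \<le> e ^ N" by (simp add: card_PiE)
qed

lemma funpow_pdiff_bounds:
  assumes "total_degree p \<le> D" "vars p \<subseteq> V"
  shows "total_degree ((pdiff i ^^ k) p) \<le> D \<and> vars ((pdiff i ^^ k) p) \<subseteq> V \<and>
    l1_norm ((pdiff i ^^ k) p) \<le> real D ^ k * l1_norm p"
proof (induction k)
  case (Suc k)
  let ?q = "(pdiff i ^^ k) p"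
  have "l1_norm (pdiff i ?q) \<le> real D * (real D ^ k * l1_norm p)"
    using Suc by (intro order.trans[OF l1_norm_pdiff_le[of ?q D]] mult_left_mono) auto
  moreover have "total_degree (pdiff i ?q) \<le> D"
    using Suc total_degree_pdiff_le[of i ?q] by linarith
  ultimately show ?case using Suc vars_pdiff_subset[of ?q V i] by simp
qed (use assms in auto)

lemma mdiff_bounds:
  assumes "total_degree p \<le> D" "vars p \<subseteq> V"
  shows "total_degree (mdiff N \<alpha> p) \<le> D \<and> vars (mdiff N \<alpha> p) \<subseteq> V \<and>
    l1_norm (mdiff N \<alpha> p) \<le> real D ^ (\<Sum>i<N. lookup \<alpha> i) * l1_norm p"
proof -
  have "total_degree (foldr (\<lambda>i. pdiff i ^^ lookup \<alpha> i) xs p) \<le> D \<and>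
     vars (foldr (\<lambda>i. pdiff i ^^ lookup \<alpha> i) xs p) \<subseteq> V \<and>
     l1_norm (foldr (\<lambda>i. pdiff i ^^ lookup \<alpha> i) xs p) \<le> real D ^ (\<Sum>i\<leftarrow>xs. lookup \<alpha> i) * l1_norm p" for xs
  proof (induction xs)
    case (Cons i xs)
    let ?q = "foldr (\<lambda>i. pdiff i ^^ lookup \<alpha> i) xs p"
    have b: "total_degree ((pdiff i ^^ lookup \<alpha> i) ?q) \<le> D \<and> vars ((pdiff i ^^ lookup \<alpha> i) ?q) \<subseteq> V \<and>
      l1_norm ((pdiff i ^^ lookup \<alpha> i) ?q) \<le> real D ^ lookup \<alpha> i * l1_norm ?q"
      using Cons by (intro funpow_pdiff_bounds) auto
    moreover have "real D ^ lookup \<alpha> i * l1_norm ?q \<le>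
        real D ^ lookup \<alpha> i * (real D ^ (\<Sum>i\<leftarrow>xs. lookup \<alpha> i) * l1_norm p)"
      using Cons by (intro mult_left_mono) auto
    ultimately show ?case by (simp add: power_add mult_ac)
  qed (use assms in auto)
  from this[of "[0..<N]"] show ?thesis
    by (simp add: mdiff_def interv_sum_list_conv_sum_set_nat atLeast0LessThan)
qed

text \<open>Since \<alpha> has degree at least 1 and \<open>h \<le> 1\<close>, one factor
  \<open>h\<close> comes out of every term, and it is this linear dependence on the width that is
  wanted. The rest is crude: at most \<open>(D + 1) ^ N\<close> exponents, a norm growth of at most
  \<open>D ^ D\<close> under differentiation, and factorials that are at least 1.\<close>

lemma centered_form_radius_le:
  fixes x :: "nat \<Rightarrow> real"
  assumes "vars F \<subseteq> {..<N}" "total_degree F \<le> D" "1 \<le> D" "\<And>i. i < N \<Longrightarrow> \<bar>x i\<bar> \<le> B" "1 \<le> B"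
    "0 \<le> h" "h \<le> 1"
  shows "(\<Sum>\<alpha> | keys \<alpha> \<subseteq> {..<N} \<and> 1 \<le> mdeg \<alpha> \<and> mdeg \<alpha> \<le> total_degree F.
            \<bar>mpeval (mdiff N \<alpha> F) x\<bar> / real (mfact \<alpha>) * h ^ mdeg \<alpha>)
         \<le> h * ((real D + 1) ^ N * real D ^ D * l1_norm F * B ^ D)"
proof -
  let ?S = "{\<alpha>. keys \<alpha> \<subseteq> {..<N} \<and> 1 \<le> mdeg \<alpha> \<and> mdeg \<alpha> \<le> total_degree F}"
  let ?T = "bounded_mindex N (D + 1)"
  let ?c = "real D ^ D * l1_norm F * B ^ D * h"
  have ST: "?S \<subseteq> ?T"
  proof
    fix \<alpha> assume a: "\<alpha> \<in> ?S"
    have "lookup \<alpha> i < D + 1" for i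
      using a assms(2) lookup_le_mdeg[of \<alpha> i] by auto
    with a show "\<alpha> \<in> ?T" by (auto simp: bounded_mindex_def)
  qed
  have c0: "0 \<le> ?c" using assms by simp
  have "(\<Sum>\<alpha>\<in>?S. \<bar>mpeval (mdiff N \<alpha> F) x\<bar> / real (mfact \<alpha>) * h ^ mdeg \<alpha>) \<le> (\<Sum>\<alpha>\<in>?S. ?c)"
  proof (rule sum_mono)
    fix \<alpha> assume a: "\<alpha> \<in> ?S"
    have "mdeg \<alpha> = (\<Sum>i<N. lookup \<alpha> i)"
      using a by (intro mdeg_superset) auto
    then have b: "total_degree (mdiff N \<alpha> F) \<le> D" "vars (mdiff N \<alpha> F) \<subseteq> {..<N}"
      "l1_norm (mdiff N \<alpha> F) \<le> real D ^ mdeg \<alpha> * l1_norm F"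
      using mdiff_bounds[OF assms(2,1), of N \<alpha>] by auto
    have "real D ^ mdeg \<alpha> \<le> real D ^ D"
      using a assms by (intro power_increasing) auto
    then have n: "l1_norm (mdiff N \<alpha> F) \<le> real D ^ D * l1_norm F"
      using b(3) by (meson l1_norm_nonneg mult_right_mono order.trans)
    have "\<bar>mpeval (mdiff N \<alpha> F) x\<bar> \<le> l1_norm (mdiff N \<alpha> F) * B ^ D"
      using assms b by (intro abs_mpeval_le[where V="{..<N}"]) auto
    also have "\<dots> \<le> real D ^ D * l1_norm F * B ^ D"
      using n assms(5) by (intro mult_right_mono) auto
    finally have 1: "\<bar>mpeval (mdiff N \<alpha> F) x\<bar> \<le> real D ^ D * l1_norm F * B ^ D" .
    have "mfact \<alpha> \<noteq> 0" by (simp add: mfact_def)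
    then have "1 \<le> real (mfact \<alpha>)" by simp
    then have "\<bar>mpeval (mdiff N \<alpha> F) x\<bar> / real (mfact \<alpha>) \<le> \<bar>mpeval (mdiff N \<alpha> F) x\<bar> / 1"
      by (intro divide_left_mono) auto
    with 1 have 2: "\<bar>mpeval (mdiff N \<alpha> F) x\<bar> / real (mfact \<alpha>) \<le> real D ^ D * l1_norm F * B ^ D"
      by simp
    have "h ^ mdeg \<alpha> \<le> h ^ 1"
      using a assms by (intro power_decreasing) auto
    then show "\<bar>mpeval (mdiff N \<alpha> F) x\<bar> / real (mfact \<alpha>) * h ^ mdeg \<alpha> \<le> ?c"
      using 2 assms by (intro mult_mono) auto
  qed
  also have "\<dots> = real (card ?S) * ?c" by simp
  also have "\<dots> \<le> real ((D + 1) ^ N) * ?c"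
    using order.trans[OF card_mono[OF finite_bounded_mindex ST] card_bounded_mindex_le[of N "D + 1"]] c0
    by (intro mult_right_mono) (simp_all only: of_nat_le_iff)
  finally show ?thesis by (simp add: mult_ac add_ac)
qed

text \<open>An interval centred at the midpoint value that contains 0 has a radius no smaller than
  the absolute value of its centre.\<close>

lemma zero_in_centered_form_bound:
  assumes "0 \<in> centered_form F Q" "vars F \<subseteq> {..<length (lower Q)}" "total_degree F \<le> D" "1 \<le> D"
    "\<And>i. i < length (lower Q) \<Longrightarrow> \<bar>cube_midpoint Q ! i\<bar> \<le> B" "1 \<le> B" "0 \<le> width Q" "width Q \<le> 2"
  shows "\<bar>mpeval F (\<lambda>i. cube_midpoint Q ! i)\<bar> \<le>
    width Q / 2 * ((real D + 1) ^ length (lower Q) * real D ^ D * l1_norm F * B ^ D)"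
proof -
  let ?x = "\<lambda>i. cube_midpoint Q ! i"
  define R where "R = (\<Sum>\<alpha> | keys \<alpha> \<subseteq> {..<length (lower Q)} \<and> 1 \<le> mdeg \<alpha> \<and> mdeg \<alpha> \<le> total_degree F.
    \<bar>mpeval (mdiff (length (lower Q)) \<alpha> F) ?x\<bar> / real (mfact \<alpha>) * (width Q / 2) ^ mdeg \<alpha>)"
  from assms(1) obtain t where t: "t \<in> {-1..1}" "0 = mpeval F ?x + R * t"
    unfolding centered_form_def Let_def R_def by auto
  have R: "R \<le> width Q / 2 * ((real D + 1) ^ length (lower Q) * real D ^ D * l1_norm F * B ^ D)"
    unfolding R_def using assms by (intro centered_form_radius_le) auto
  have R0: "0 \<le> R" unfolding R_def using assms(7) by (intro sum_nonneg) auto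
  have "\<bar>mpeval F ?x\<bar> = \<bar>R * t\<bar>" using t(2) by (simp add: eq_neg_iff_add_eq_0)
  also have "\<dots> \<le> R * 1" unfolding abs_mult using t(1) R0 by (intro mult_mono) auto
  finally show ?thesis using R by simp
qed

subsection \<open>Integer polynomials as real polynomials\<close>

lemma lookup_real_poly: "lookup (real_poly p) \<alpha> = of_int (lookup p \<alpha>)"
  by (simp add: real_poly_def Poly_Mapping.map.rep_eq when_def)

lemma keys_real_poly [simp]: "keys (real_poly p) = keys p"
  by (auto simp: in_keys_iff lookup_real_poly)

lemma vars_real_poly [simp]: "vars (real_poly p) = vars p"
  by (simp add: vars_def)

lemma total_degree_real_poly [simp]: "total_degree (real_poly p) = total_degree p"
  by (simp add: total_degree_def)

lemma int_coeffs_real_poly: "int_coeffs (real_poly p)"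
  by (simp add: int_coeffs_def lookup_real_poly)

subsection \<open>The subdivision process\<close>

lemma
  shows finite_subcubes: "finite (subcubes J)"
    and card_subcubes_le: "card (subcubes J) \<le> 2 ^ length (lower J)"
proof -
  let ?n = "length (lower J)"
  let ?f = "\<lambda>\<sigma>. Cube (map (\<lambda>i. lower J ! i + \<sigma> i) [0..<?n]) (width J / 2)"
  let ?S = "PiE {..<?n} (\<lambda>_. {0, width J / 2})"
  have sub: "subcubes J \<subseteq> ?f ` ?S"
  proof
    fix K assume "K \<in> subcubes J"
    then obtain b where K: "K = Cube b (width J / 2)" and l: "length b = ?n"
      and b: "\<And>i. i < ?n \<Longrightarrow> b ! i = lower J ! i \<or> b ! i = lower J ! i + width J / 2"
      by (auto simp: subcubes_def)
    let ?\<sigma> = "restrict (\<lambda>i. b ! i - lower J ! i) {..<?n}"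
    have "?\<sigma> \<in> ?S"
    proof (rule PiE_I)
      fix i assume "i \<in> {..<?n}"
      with b[of i] show "?\<sigma> i \<in> {0, width J / 2}" by auto
    qed simp
    moreover have "b = map (\<lambda>i. lower J ! i + ?\<sigma> i) [0..<?n]"
      by (rule nth_equalityI) (simp_all add: l)
    then have "K = ?f ?\<sigma>" unfolding K by simp
    ultimately show "K \<in> ?f ` ?S" by blast
  qed
  have fin: "finite ?S" by (intro finite_PiE) auto
  show "finite (subcubes J)" using sub fin by (rule finite_surj[rotated])
  have "card (subcubes J) \<le> card ?S"
    using sub fin by (meson card_image_le card_mono finite_imageI order.trans)
  also have "\<dots> \<le> (\<Prod>i<?n. 2)"
    unfolding card_PiE[OF finite_lessThan] by (intro prod_mono) (auto simp: card_insert_if)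
  finally show "card (subcubes J) \<le> 2 ^ ?n" by simp
qed

text \<open>Containment is inherited under bisection, and it keeps midpoints inside the box of
  \<open>I\<close>, where the lower bound for \<open>G\<close> holds.\<close>

definition subcube_of :: "cube \<Rightarrow> cube \<Rightarrow> bool" where
  "subcube_of I J \<longleftrightarrow> length (lower J) = length (lower I) \<and> 0 < width J \<and>
     (\<forall>i<length (lower I). lower I ! i \<le> lower J ! i \<and> lower J ! i + width J \<le> lower I ! i + width I)"

text \<open>This drops by at least \<open>v\<close> at every subdivision step if \<open>v\<close> bounds the volumes of all occurring
  cubes from below.\<close>

definition pv_potential :: "nat \<Rightarrow> real \<Rightarrow> cube set \<Rightarrow> real" where
  "pv_potential n v P = (\<Sum>J\<in>P. 2 * width J ^ n - v)"

text \<open>Only cubes of width at least \<open>w0\<close> are split, so all widths stay at least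
  \<open>w0 / 2\<close>, and v = (w0/2)^n bounds all volumes from below. Splitting a cube of width w
  replaces 2w^n - v by at most 2^n (2(w/2)^n - v) = 2w^n - 2^n v, a loss of at least v since n is
  positive. The factor 2 keeps each summand at least v, so the potential also bounds v times the
  number of cubes.\<close>

lemma pv_bounds:
  assumes I: "is_cube n I" and n: "1 \<le> n" and w0: "0 < w0" "w0 \<le> width I"
    and big: "\<And>J. subcube_of I J \<Longrightarrow> \<not> C0 f J \<Longrightarrow> \<not> C1 n f J \<Longrightarrow> w0 \<le> width J"
  shows "pv_terminates n f I"
    and "pv_output n f I P \<Longrightarrow> finite P \<and> real (card P) \<le> 2 * (2 * width I / w0) ^ n"
proof -
  define v where "v = (w0 / 2) ^ n"
  have v: "0 < v" using w0 by (simp add: v_def)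
  define invar where "invar P \<longleftrightarrow> finite P \<and> (\<forall>J\<in>P. subcube_of I J \<and> w0 / 2 \<le> width J)" for P
  have vol: "v \<le> 2 * width J ^ n - v" if "w0 / 2 \<le> width J" for J
    using power_mono[OF that, of n] w0 by (simp add: v_def)
  have nI: "length (lower I) = n" using I by (simp add: is_cube_def)
  have step: "invar P' \<and> pv_potential n v P' \<le> pv_potential n v P - v" if invar: "invar P" and st: "pv_step n f P P'" for P P'
  proof -
    obtain J where J: "J \<in> P" "\<not> C0 f J" "\<not> C1 n f J" and P': "P' = (P - {J}) \<union> subcubes J"
      using st by (auto simp: pv_step_def)
    have sJ: "subcube_of I J" and fin: "finite P" using invar J by (auto simp: invar_def)
    have wJ: "w0 \<le> width J" by (rule big[OF sJ J(2,3)])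
    have nJ: "length (lower J) = n" using sJ nI by (simp add: subcube_of_def)
    have child: "subcube_of I K \<and> width K = width J / 2" if "K \<in> subcubes J" for K
    proof -
      obtain b where K: "K = Cube b (width J / 2)" and l: "length b = n"
        and b: "\<And>i. i < n \<Longrightarrow> b ! i = lower J ! i \<or> b ! i = lower J ! i + width J / 2"
        using \<open>K \<in> subcubes J\<close> nJ by (auto simp: subcubes_def)
      have "lower I ! i \<le> b ! i \<and> b ! i + width J / 2 \<le> lower I ! i + width I" if "i < n" for i
        using sJ b[OF that] that nI unfolding subcube_of_def by fastforce
      then show ?thesis using sJ l nI by (auto simp: K subcube_of_def)
    qed
    have invar': "invar P'"
      using invar child wJ by (auto simp: invar_def P' finite_subcubes)
    have nonneg: "0 \<le> 2 * width K ^ n - v" if "K \<in> P' \<union> P" for K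
    proof -
      have "w0 / 2 \<le> width K" using that invar invar' by (auto simp: invar_def)
      from vol[OF this] v show ?thesis by linarith
    qed
    let ?c = "2 * (width J / 2) ^ n - v"
    \<comment> \<open>As \<open>P\<close> is a set, a new subcube might already belong to it.
      Counting such a cube twice only increases the right-hand side, since summands are nonnegative,
      so disjointness need not be tracked.\<close>
    have "pv_potential n v P' \<le> pv_potential n v (P - {J}) + pv_potential n v (subcubes J)"
    proof -
      have "pv_potential n v (P - {J}) + pv_potential n v (subcubes J) =
          pv_potential n v P' + (\<Sum>K\<in>(P - {J}) \<inter> subcubes J. 2 * width K ^ n - v)"
        unfolding pv_potential_def P' using fin finite_subcubes
        by (intro sum.union_inter[symmetric]) auto
      moreover have "0 \<le> (\<Sum>K\<in>(P - {J}) \<inter> subcubes J. 2 * width K ^ n - v)"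
        by (rule sum_nonneg) (use nonneg in auto)
      ultimately show ?thesis by linarith
    qed
    also have "pv_potential n v (subcubes J) = real (card (subcubes J)) * ?c"
      unfolding pv_potential_def by (subst sum.cong[OF refl, of _ _ "\<lambda>_. ?c"]) (simp_all add: child)
    also have "\<dots> \<le> 2 ^ n * ?c"
    proof (rule mult_right_mono)
      show "real (card (subcubes J)) \<le> 2 ^ n"
        using card_subcubes_le[of J] nJ by (metis of_nat_le_iff of_nat_numeral of_nat_power)
      have "(w0 / 2) ^ n \<le> (width J / 2) ^ n" using wJ w0 by (intro power_mono) auto
      then show "0 \<le> ?c" using v by (simp add: v_def)
    qed
    also have "2 ^ n * ?c = 2 * width J ^ n - 2 ^ n * v"
      by (simp add: power_divide algebra_simps)
    also have "\<dots> \<le> 2 * width J ^ n - 2 * v"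
      using power_increasing[OF n, of "2::real"] v by simp
    also have "pv_potential n v (P - {J}) = pv_potential n v P - (2 * width J ^ n - v)"
      unfolding pv_potential_def using fin J(1) by (simp add: sum_diff1)
    finally show ?thesis using invar' by simp
  qed
  have inv0: "invar {I}"
    using I w0 by (auto simp: invar_def subcube_of_def is_cube_def)
  have pot: "real (card P) * v \<le> pv_potential n v P" if "invar P" for P
  proof -
    have "(\<Sum>J\<in>P. v) \<le> pv_potential n v P"
      unfolding pv_potential_def by (rule sum_mono) (use that vol in \<open>auto simp: invar_def\<close>)
    then show ?thesis by simp
  qed
  show "pv_terminates n f I"
    unfolding pv_terminates_def
  proof
    assume "\<exists>P. P 0 = {I} \<and> (\<forall>k. pv_step n f (P k) (P (Suc k)))"
    then obtain P where P: "P 0 = {I}" "\<And>k. pv_step n f (P k) (P (Suc k))" by blast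
    have k: "invar (P k) \<and> pv_potential n v (P k) \<le> pv_potential n v {I} - real k * v" for k
    proof (induction k)
      case (Suc k)
      with step[OF _ P(2)[of k]] show ?case by (auto simp: algebra_simps)
    qed (use inv0 P in auto)
    obtain k where "pv_potential n v {I} < real k * v"
      using reals_Archimedean3[OF v] by blast
    moreover have "0 \<le> pv_potential n v (P k)"
      using pot[of "P k"] k[of k] v by (meson mult_nonneg_nonneg of_nat_0_le_iff order.trans less_imp_le)
    ultimately show False using k[of k] by linarith
  qed
  show "finite P \<and> real (card P) \<le> 2 * (2 * width I / w0) ^ n" if "pv_output n f I P"
  proof -
    from that have "(pv_step n f)\<^sup>*\<^sup>* {I} P" by (simp add: pv_output_def)
    then have P: "invar P \<and> pv_potential n v P \<le> pv_potential n v {I}"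
    proof (induction rule: rtranclp_induct)
      case (step P P')
      with \<open>\<And>P' P. invar P \<Longrightarrow> pv_step n f P P' \<Longrightarrow> invar P' \<and> pv_potential n v P' \<le> pv_potential n v P - v\<close>[of P P'] v
      show ?case by auto
    qed (use inv0 in auto)
    have "real (card P) * v \<le> 2 * width I ^ n"
      using pot[of P] P v by (auto simp: pv_potential_def)
    then have "real (card P) \<le> 2 * width I ^ n / v" using v by (simp add: field_simps)
    also have "\<dots> = 2 * (2 * width I / w0) ^ n"
      by (simp add: v_def power_divide power_mult_distrib)
    finally show ?thesis using P by (simp add: invar_def)
  qed
qed

text \<open>\<open>C\<^sub>1\<close> evaluates the gradient product on the diagonal, where it is \<open>|\<nabla>f|\<^sup>2\<close>.\<close>

lemma nonterminal_cube_energy_le: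
  assumes J: "length (lower J) = n" "0 < width J" "width J \<le> 2" and f: "vars f \<subseteq> {..<n}" "total_degree f \<le> d" "1 \<le> d"
    and B: "\<And>i. i < n \<Longrightarrow> \<bar>cube_midpoint J ! i\<bar> \<le> B" "1 \<le> B"
    and C: "\<not> C0 f J" "\<not> C1 n f J"
  defines "\<Phi> \<equiv> l1_norm f"
  shows "mpeval (grad_energy n f) (\<lambda>i. cube_midpoint J ! i) \<le>
    width J * ((2 * real d + 1) ^ (2 * n) * (2 * real d) ^ (2 * d) * ((1 + real n * (real d)\<^sup>2) * \<Phi>\<^sup>2) * B ^ (2 * d))"
proof -
  let ?x = "\<lambda>i. cube_midpoint J ! i" and ?Q = "cube_square J"
  let ?y = "\<lambda>i. cube_midpoint ?Q ! i"
  have \<Phi>: "0 \<le> \<Phi>" by (simp add: \<Phi>_def)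
  have lx: "length (cube_midpoint J) = n" using J by (simp add: cube_midpoint_def)
  have y: "cube_midpoint ?Q = cube_midpoint J @ cube_midpoint J" by (simp add: cube_midpoint_def cube_square_def)
  have lQ: "length (lower ?Q) = n + n" and wQ: "width ?Q = width J" using J by (simp_all add: cube_square_def)
  have y1: "?y i = ?x i" "?y (i + n) = ?x i" if "i < n" for i
    using that lx by (simp_all add: y nth_append)
  have f1: "\<bar>mpeval f ?x\<bar> \<le> width J / 2 * ((real d + 1) ^ n * real d ^ d * \<Phi> * B ^ d)"
    unfolding \<Phi>_def J(1)[symmetric]
  proof (rule zero_in_centered_form_bound)
    show "0 \<in> centered_form f J" using C by (simp add: C0_def)
    show "\<bar>?x i\<bar> \<le> B" if "i < length (lower J)" for i
      using B(1)[of i] that J(1) by simp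
  qed (use f B J in simp_all)
  \<comment> \<open>To bound the square of \<open>f\<close> linearly in the width, one factor is
    estimated by the failed test (\<open>f1\<close>) and the other by this bound, which does not
    involve the width.\<close>
  have f2: "\<bar>mpeval f ?x\<bar> \<le> \<Phi> * B ^ d"
    unfolding \<Phi>_def using f B by (intro abs_mpeval_le[where V = "{..<n}"]) auto
  let ?g = "grad_product n f"
  have "\<bar>mpeval ?g ?y\<bar> \<le> width ?Q / 2 * ((real (2 * d) + 1) ^ length (lower ?Q) * real (2 * d) ^ (2 * d) * l1_norm ?g * B ^ (2 * d))"
  proof (rule zero_in_centered_form_bound)
    show "0 \<in> centered_form ?g ?Q" using C by (simp add: C1_def)
    show "vars ?g \<subseteq> {..<length (lower ?Q)}" unfolding lQ by (rule vars_grad_product_subset[OF f(1)])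
    show "total_degree ?g \<le> 2 * d" using total_degree_grad_product_le[of n f] f by linarith
    show "\<bar>?y i\<bar> \<le> B" if "i < length (lower ?Q)" for i
    proof (cases "i < n")
      case True
      show ?thesis unfolding y1(1)[OF True] by (rule B(1)[OF True])
    next
      case False
      then have i: "i - n < n" "i - n + n = i" using that lQ by auto
      show ?thesis using y1(2)[OF i(1)] B(1)[OF i(1)] unfolding i(2) by simp
    qed
  qed (use f B J in \<open>simp_all add: wQ\<close>)
  also have "mpeval ?g ?y = (\<Sum>i<n. (mpeval (pdiff i f) ?x)\<^sup>2)"
    unfolding mpeval_grad_product power2_eq_square
  proof (intro sum.cong refl arg_cong2[where f = "(*)"] mpeval_cong)
    fix i j assume "j \<in> vars (pdiff i f)"
    then have "j < n" using vars_pdiff_subset[OF f(1)] by blast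
    then show "?y j = ?x j" "?y (j + n) = ?x j" by (rule y1)+
  qed
  finally have g1: "(\<Sum>i<n. (mpeval (pdiff i f) ?x)\<^sup>2) \<le>
      width J / 2 * ((2 * real d + 1) ^ (2 * n) * (2 * real d) ^ (2 * d) * l1_norm ?g * B ^ (2 * d))"
    by (simp add: lQ wQ flip: mult_2)
  \<comment> \<open>The constant for the gradient product, of degree at most \<open>2 * d\<close> in
    \<open>2 * n\<close> variables, also dominates the one for \<open>f\<close>; thus both estimates
    can be added.\<close>
  let ?A = "(2 * real d + 1) ^ (2 * n) * (2 * real d) ^ (2 * d)"
  have A: "0 \<le> ?A" by simp
  have "(mpeval f ?x)\<^sup>2 = \<bar>mpeval f ?x\<bar> * \<bar>mpeval f ?x\<bar>" by (simp add: power2_eq_square)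
  also have "\<dots> \<le> (width J / 2 * ((real d + 1) ^ n * real d ^ d * \<Phi> * B ^ d)) * (\<Phi> * B ^ d)"
    using f1 f2 by (intro mult_mono) auto
  also have "\<dots> = width J / 2 * (((real d + 1) ^ n * real d ^ d) * \<Phi>\<^sup>2 * B ^ (2 * d))"
    unfolding power_even_eq power2_eq_square by (simp only: mult_ac)
  also have "\<dots> \<le> width J / 2 * (?A * \<Phi>\<^sup>2 * B ^ (2 * d))"
  proof -
    have "(real d + 1) ^ n \<le> (2 * real d + 1) ^ n" by (intro power_mono) auto
    also have "\<dots> \<le> (2 * real d + 1) ^ (2 * n)" by (intro power_increasing) auto
    finally have 1: "(real d + 1) ^ n \<le> (2 * real d + 1) ^ (2 * n)" .
    have "real d ^ d \<le> (2 * real d) ^ d" by (intro power_mono) auto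
    also have "\<dots> \<le> (2 * real d) ^ (2 * d)" using f by (intro power_increasing) auto
    finally have 2: "real d ^ d \<le> (2 * real d) ^ (2 * d)" .
    show ?thesis using 1 2 J B by (intro mult_left_mono mult_right_mono mult_mono) auto
  qed
  finally have f3: "(mpeval f ?x)\<^sup>2 \<le> width J / 2 * (?A * \<Phi>\<^sup>2 * B ^ (2 * d))" .
  have "l1_norm ?g \<le> real n * (real d * \<Phi>)\<^sup>2"
    unfolding \<Phi>_def by (rule l1_norm_grad_product_le[OF f(2)])
  then have "width J / 2 * (?A * l1_norm ?g * B ^ (2 * d)) \<le> width J / 2 * (?A * (real n * (real d * \<Phi>)\<^sup>2) * B ^ (2 * d))"
    using J B A by (intro mult_left_mono mult_right_mono) auto
  with g1 f3 have "mpeval (grad_energy n f) ?x \<le>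
      width J / 2 * (?A * \<Phi>\<^sup>2 * B ^ (2 * d)) + width J / 2 * (?A * (real n * (real d * \<Phi>)\<^sup>2) * B ^ (2 * d))"
    unfolding mpeval_grad_energy by linarith
  also have "\<dots> = width J / 2 * (?A * ((1 + real n * (real d)\<^sup>2) * \<Phi>\<^sup>2) * B ^ (2 * d))"
    by (simp add: algebra_simps power_mult_distrib)
  also have "\<dots> \<le> width J * (?A * ((1 + real n * (real d)\<^sup>2) * \<Phi>\<^sup>2) * B ^ (2 * d))"
    using J B by (intro mult_right_mono) auto
  finally show ?thesis .
qed

section \<open>Lower bound for a positive limit of eigenvalues of integer polynomial
  matrices\<close>

subsection \<open>Norms of determinants\<close>

text \<open>Abstract so that the l1 construction \<open>poly_norm\<close> can be iterated from Z to
  Z[t] and on to Z[t][s], with a single proof of the determinant bound.\<close>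

locale ring_norm =
  fixes \<nu> :: "'a::comm_ring_1 \<Rightarrow> real"
  assumes norm_nonneg: "0 \<le> \<nu> a"
    and norm_0 [simp]: "\<nu> 0 = 0"
    and norm_1: "\<nu> 1 \<le> 1"
    and norm_add: "\<nu> (a + b) \<le> \<nu> a + \<nu> b"
    and norm_mult: "\<nu> (a * b) \<le> \<nu> a * \<nu> b"
    and norm_uminus [simp]: "\<nu> (- a) = \<nu> a"
begin

lemma norm_sum: "\<nu> (\<Sum>j\<in>S. f j) \<le> (\<Sum>j\<in>S. \<nu> (f j))"
proof (induction S rule: infinite_finite_induct)
  case (insert j S)
  then show ?case using norm_add[of "f j" "\<Sum>j\<in>S. f j"] by auto
qed auto

lemma norm_prod: "\<nu> (\<Prod>j\<in>S. f j) \<le> (\<Prod>j\<in>S. \<nu> (f j))"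
proof (induction S rule: infinite_finite_induct)
  case (insert j S)
  have "\<nu> (f j * (\<Prod>j\<in>S. f j)) \<le> \<nu> (f j) * (\<Prod>j\<in>S. \<nu> (f j))"
    by (rule order.trans[OF norm_mult mult_left_mono[OF insert.IH norm_nonneg]])
  with insert show ?case by simp
qed (use norm_1 in auto)

lemma norm_diff: "\<nu> (a - b) \<le> \<nu> a + \<nu> b"
  using norm_add[of a "- b"] by simp

text \<open>The Leibniz expansion has N! terms, each a signed product of N entries.\<close>

lemma norm_det_le:
  assumes A: "A \<in> carrier_mat N N"
    and B: "\<And>k l. k < N \<Longrightarrow> l < N \<Longrightarrow> \<nu> (A $$ (k, l)) \<le> B"
  shows "\<nu> (Determinant.det A) \<le> fact N * B ^ N"
proof -
  let ?P = "{p. p permutes {0..<N}}"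
  have "\<nu> (Determinant.det A) \<le> (\<Sum>p\<in>?P. B ^ N)"
    unfolding det_def'[OF A]
  proof (intro order.trans[OF norm_sum] sum_mono)
    fix p assume "p \<in> ?P"
    then have p: "p i < N" if "i < N" for i
      using permutes_in_image[of p "{0..<N}" i] that by auto
    have "\<nu> (signof p * (\<Prod>i = 0..<N. A $$ (i, p i))) = \<nu> (\<Prod>i = 0..<N. A $$ (i, p i))"
      by (cases "signof p = (1::'a)") (auto simp: sign_def)
    also have "\<dots> \<le> (\<Prod>i = 0..<N. B)"
      by (intro order.trans[OF norm_prod] prod_mono) (use B p norm_nonneg in auto)
    finally show "\<nu> (signof p * (\<Prod>i = 0..<N. A $$ (i, p i))) \<le> B ^ N" by simp
  qed
  also have "\<dots> = fact N * B ^ N"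
    by (simp add: card_permutations[of "{0..<N}" N])
  finally show ?thesis .
qed

definition poly_norm :: "'a poly \<Rightarrow> real" where
  "poly_norm p = (\<Sum>i\<le>degree p. \<nu> (coeff p i))"

lemma poly_norm_superset:
  assumes "degree p \<le> n"
  shows "poly_norm p = (\<Sum>i\<le>n. \<nu> (coeff p i))"
  unfolding poly_norm_def
  by (rule sum.mono_neutral_left) (use assms in \<open>auto simp: coeff_eq_0\<close>)

lemma norm_coeff_le_poly_norm: "\<nu> (coeff p i) \<le> poly_norm p"
proof (cases "i \<le> degree p")
  case True
  then show ?thesis
    unfolding poly_norm_def by (intro member_le_sum) (auto simp: norm_nonneg)
next
  case False
  then show ?thesis by (simp add: coeff_eq_0 poly_norm_def sum_nonneg norm_nonneg)
qed

lemma poly_norm_nonneg: "0 \<le> poly_norm p"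
  by (simp add: poly_norm_def sum_nonneg norm_nonneg)

lemma poly_norm_0 [simp]: "poly_norm 0 = 0"
  by (simp add: poly_norm_def)

lemma poly_norm_pCons [simp]: "poly_norm (pCons a p) = \<nu> a + poly_norm p"
proof -
  have "poly_norm (pCons a p) = (\<Sum>i\<le>Suc (degree p). \<nu> (coeff (pCons a p) i))"
    by (rule poly_norm_superset) (rule degree_pCons_le)
  also have "\<dots> = \<nu> a + poly_norm p"
    unfolding sum.atMost_Suc_shift by (simp add: poly_norm_def)
  finally show ?thesis .
qed

lemma poly_norm_add: "poly_norm (p + q) \<le> poly_norm p + poly_norm q"
proof -
  let ?n = "max (degree p) (degree q)"
  have "poly_norm (p + q) = (\<Sum>i\<le>?n. \<nu> (coeff (p + q) i))"
    by (rule poly_norm_superset) (rule degree_add_le_max)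
  also have "\<dots> \<le> (\<Sum>i\<le>?n. \<nu> (coeff p i) + \<nu> (coeff q i))"
    by (intro sum_mono) (simp add: norm_add)
  also have "\<dots> = poly_norm p + poly_norm q"
    by (simp add: sum.distrib poly_norm_superset[of p ?n] poly_norm_superset[of q ?n])
  finally show ?thesis .
qed

lemma poly_norm_smult: "poly_norm (Polynomial.smult a p) \<le> \<nu> a * poly_norm p"
proof (induction p)
  case (pCons b p)
  have "\<nu> (a * b) + poly_norm (Polynomial.smult a p) \<le> \<nu> a * \<nu> b + \<nu> a * poly_norm p"
    by (intro add_mono norm_mult pCons)
  then show ?case by (simp add: algebra_simps)
qed simp

lemma poly_norm_mult: "poly_norm (p * q) \<le> poly_norm p * poly_norm q"
proof (induction p)
  case (pCons a p)
  have "poly_norm (pCons a p * q) \<le> poly_norm (Polynomial.smult a q) + poly_norm (pCons 0 (p * q))"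
    unfolding mult_pCons_left by (rule poly_norm_add)
  also have "\<dots> \<le> \<nu> a * poly_norm q + poly_norm p * poly_norm q"
    using poly_norm_smult pCons by (simp add: add_mono)
  finally show ?case by (simp add: algebra_simps)
qed simp

lemma ring_norm_poly_norm: "ring_norm poly_norm"
proof
  show "poly_norm (- p) = poly_norm p" for p by (simp add: poly_norm_def)
  show "poly_norm 1 \<le> 1" by (simp add: one_pCons norm_1)
qed (simp_all add: poly_norm_nonneg poly_norm_add poly_norm_mult)

end

lemma ring_norm_abs_int: "ring_norm (\<lambda>a::int. \<bar>real_of_int a\<bar>)"
  by unfold_locales (auto simp: abs_mult)

interpretation int_poly: ring_norm "ring_norm.poly_norm (\<lambda>a::int. \<bar>real_of_int a\<bar>)"
  by (rule ring_norm.ring_norm_poly_norm[OF ring_norm_abs_int])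

interpretation abs_int: ring_norm "\<lambda>a::int. \<bar>real_of_int a\<bar>"
  by (rule ring_norm_abs_int)

interpretation int_poly_poly: ring_norm "ring_norm.poly_norm (ring_norm.poly_norm (\<lambda>a::int. \<bar>real_of_int a\<bar>))"
  by (rule int_poly.ring_norm_poly_norm)

abbreviation int_poly_norm :: "int poly \<Rightarrow> real" where
  "int_poly_norm \<equiv> abs_int.poly_norm"

abbreviation int_poly2_norm :: "int poly poly \<Rightarrow> real" where
  "int_poly2_norm \<equiv> int_poly.poly_norm"

subsection \<open>Roots at infinity\<close>

definition int_poly_eval :: "real \<Rightarrow> int poly \<Rightarrow> real" where
  "int_poly_eval t p = poly (of_int_poly p) t"

lemma int_poly_eval_sum: "int_poly_eval t p = (\<Sum>i\<le>degree p. of_int (coeff p i) * t ^ i)"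
  by (simp add: int_poly_eval_def poly_altdef)

lemma comm_ring_hom_int_poly_eval: "comm_ring_hom (int_poly_eval t)"
  by unfold_locales (simp_all add: int_poly_eval_def hom_distribs)

text \<open>After division by a power of the variable the constant coefficient is a nonzero integer,
  hence at least 1 in absolute value. At a root \<mu> < 1 it is cancelled by the other terms, which
  together are at most \<mu> times the norm.\<close>

lemma root_lower_bound:
  assumes "p \<noteq> 0" "int_poly_eval \<mu> p = 0" "0 < \<mu>" "int_poly_norm p \<le> L" "1 \<le> L"
  shows "1 / L \<le> \<mu>"
proof (cases "\<mu> < 1")
  case True
  obtain k r where r: "p = [:0, 1:] ^ k * r" and nd: "\<not> [:-0, 1:] dvd r"
    using order_decomp[OF assms(1), of 0] by auto
  have r0: "coeff r 0 \<noteq> 0"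
    using nd poly_eq_0_iff_dvd[of r 0] by (simp add: poly_0_coeff_0)
  interpret e: comm_ring_hom "int_poly_eval \<mu>" by (rule comm_ring_hom_int_poly_eval)
  have "int_poly_eval \<mu> [:0, 1:] = \<mu>"
    by (simp add: int_poly_eval_def)
  then have "\<mu> ^ k * int_poly_eval \<mu> r = 0"
    using assms(2) unfolding r by (simp add: e.hom_mult e.hom_power)
  then have z: "int_poly_eval \<mu> r = 0" using assms(3) by simp
  \<comment> \<open>Multiplying by the variable only shifts the coefficients.\<close>
  have nr: "int_poly_norm r = int_poly_norm p"
  proof -
    have "int_poly_norm ([:0, 1:] ^ k * r) = int_poly_norm r" for k
      by (induction k) (simp_all add: mult.assoc)
    then show ?thesis unfolding r by simp
  qed
  have "int_poly_eval \<mu> r = of_int (coeff r 0) + (\<Sum>i\<in>{..degree r} - {0}. of_int (coeff r i) * \<mu> ^ i)"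
    unfolding int_poly_eval_sum by (subst sum.remove[of _ 0]) auto
  with z have "\<bar>of_int (coeff r 0)\<bar> = \<bar>\<Sum>i\<in>{..degree r} - {0}. of_int (coeff r i) * \<mu> ^ i\<bar>"
    by linarith
  also have "\<dots> \<le> (\<Sum>i\<in>{..degree r} - {0}. \<bar>of_int (coeff r i)\<bar> * \<mu> ^ i)"
    using assms(3) by (intro order.trans[OF sum_abs] sum_mono) (simp add: abs_mult)
  also have "\<dots> \<le> (\<Sum>i\<in>{..degree r} - {0}. \<bar>of_int (coeff r i)\<bar> * \<mu>)"
  proof (intro sum_mono mult_left_mono)
    fix i assume "i \<in> {..degree r} - {0::nat}"
    then have "\<mu> ^ i \<le> \<mu> ^ 1"
      using True assms(3) by (intro power_decreasing) auto
    then show "\<mu> ^ i \<le> \<mu>" by simp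
  qed auto
  also have "\<dots> \<le> (\<Sum>i\<in>{..degree r}. \<bar>of_int (coeff r i)\<bar> * \<mu>)"
    using assms(3) by (intro sum_mono2) auto
  also have "\<dots> = int_poly_norm r * \<mu>"
    by (simp add: abs_int.poly_norm_def sum_distrib_right)
  also have "\<dots> \<le> L * \<mu>" using nr assms by (intro mult_right_mono) auto
  finally have "\<bar>of_int (coeff r 0)\<bar> \<le> L * \<mu>" .
  moreover have "1 \<le> \<bar>of_int (coeff r 0) :: real\<bar>"
    using r0 by linarith
  ultimately show ?thesis using assms by (simp add: field_simps)
next
  case False
  then show ?thesis using assms mult_mono[of 1 L 1 \<mu>] by (simp add: field_simps)
qed

text \<open>In \<^typ>\<open>int poly poly\<close> the outer variable is the parameter \<open>s\<close> and the inner one the eigenvalue \<open>t\<close>.\<close>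

definition int_poly2_eval :: "real \<Rightarrow> real \<Rightarrow> int poly poly \<Rightarrow> real" where
  "int_poly2_eval s t p = poly (map_poly (int_poly_eval t) p) s"

lemma comm_ring_hom_int_poly2_eval: "comm_ring_hom (int_poly2_eval s t)"
proof -
  interpret e: comm_ring_hom "int_poly_eval t" by (rule comm_ring_hom_int_poly_eval)
  interpret m: map_poly_comm_ring_hom "int_poly_eval t" ..
  show ?thesis
    by unfold_locales (simp_all add: int_poly2_eval_def m.hom_add m.hom_mult)
qed

text \<open>Specialising \<open>t\<close> may lower the degree in \<open>s\<close>. Summing up to
  the formal degree keeps the same leading coefficient for all values of \<open>t\<close>.\<close>

lemma int_poly2_eval_sum:
  "int_poly2_eval s t p = (\<Sum>j\<le>degree p. int_poly_eval t (coeff p j) * s ^ j)"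
proof -
  interpret e: comm_ring_hom "int_poly_eval t" by (rule comm_ring_hom_int_poly_eval)
  have "int_poly2_eval s t p =
      (\<Sum>j\<le>degree (map_poly (int_poly_eval t) p). int_poly_eval t (coeff p j) * s ^ j)"
    by (simp add: int_poly2_eval_def poly_altdef coeff_map_poly)
  also have "\<dots> = (\<Sum>j\<le>degree p. int_poly_eval t (coeff p j) * s ^ j)"
  proof (rule sum.mono_neutral_left)
    show "\<forall>i\<in>{..degree p} - {..degree (map_poly (int_poly_eval t) p)}. int_poly_eval t (coeff p i) * s ^ i = 0"
      using coeff_eq_0[of "map_poly (int_poly_eval t) p"] by (auto simp: coeff_map_poly)
  qed (auto simp: degree_map_poly_le)
  finally show ?thesis .
qed

lemma tendsto_int_poly_eval: "(t \<longlongrightarrow> \<mu>) F \<Longrightarrow> ((\<lambda>j. int_poly_eval (t j) p) \<longlongrightarrow> int_poly_eval \<mu> p) F"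
  unfolding int_poly_eval_def by (rule tendsto_poly)

text \<open>Divide by the top power of \<open>s\<close>: the values of the lower coefficients
  converge along \<open>t\<close>, so divided by positive powers of \<open>s\<close> they tend to 0,
  and only the leading coefficient survives.\<close>

lemma root_at_infinity:
  assumes s: "filterlim s at_top sequentially" and t: "t \<longlonglongrightarrow> \<mu>"
    and root: "\<And>j. int_poly2_eval (s j) (t j) p = 0"
  shows "int_poly_eval \<mu> (lead_coeff p) = 0"
proof -
  let ?D = "degree p"
  let ?g = "\<lambda>j. (\<Sum>k<?D. int_poly_eval (t j) (coeff p k) * (1 / s j ^ (?D - k))) + int_poly_eval (t j) (lead_coeff p)"
  have s0: "(\<lambda>j. 1 / s j ^ (?D - k)) \<longlonglongrightarrow> 0" if "k < ?D" for k
    by (rule tendsto_divide_0[OF tendsto_const], rule filterlim_at_top_imp_at_infinity,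
        rule filterlim_pow_at_top[OF _ s]) (use that in simp)
  have "?g \<longlonglongrightarrow> (\<Sum>k<?D. int_poly_eval \<mu> (coeff p k) * 0) + int_poly_eval \<mu> (lead_coeff p)"
    by (rule tendsto_add, rule tendsto_sum, rule tendsto_mult) (simp_all add: tendsto_int_poly_eval t s0)
  moreover have "\<forall>\<^sub>F j in sequentially. ?g j = 0"
  proof -
    have "\<forall>\<^sub>F j in sequentially. 0 < s j"
      using s by (simp add: filterlim_at_top_dense)
    then show ?thesis
    proof eventually_elim
      case (elim j)
      have pw: "s j ^ k = s j ^ ?D * (1 / s j ^ (?D - k))" if "k < ?D" for k
      proof -
        have "s j ^ ?D = s j ^ k * s j ^ (?D - k)"
          using that by (simp flip: power_add)
        then show ?thesis using elim by simp
      qed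
      have "(\<Sum>k<?D. int_poly_eval (t j) (coeff p k) * s j ^ k) =
          s j ^ ?D * (\<Sum>k<?D. int_poly_eval (t j) (coeff p k) * (1 / s j ^ (?D - k)))"
        unfolding sum_distrib_left
      proof (rule sum.cong[OF refl])
        fix k assume "k \<in> {..<?D}"
        then have "int_poly_eval (t j) (coeff p k) * s j ^ k =
            int_poly_eval (t j) (coeff p k) * (s j ^ ?D * (1 / s j ^ (?D - k)))"
          using pw[of k] by (intro arg_cong2[where f = "(*)"]) auto
        then show "int_poly_eval (t j) (coeff p k) * s j ^ k =
            s j ^ ?D * (int_poly_eval (t j) (coeff p k) * (1 / s j ^ (?D - k)))"
          by (simp only: mult.left_commute)
      qed
      then have "int_poly2_eval (s j) (t j) p = s j ^ ?D * ?g j"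
        unfolding int_poly2_eval_sum lessThan_Suc_atMost[symmetric] sum.lessThan_Suc distrib_left
        by (simp only: mult.commute[of "int_poly_eval (t j) (lead_coeff p)"])
      then have "s j ^ ?D * ?g j = 0" using root[of j] by simp
      with elim show ?case by simp
    qed
  qed
  then have "?g \<longlonglongrightarrow> 0" by (rule tendsto_eventually)
  ultimately show ?thesis using LIMSEQ_unique by fastforce
qed

subsection \<open>Limits of parametrised eigenvalues\<close>

lemma eigenvalue_det_eq_0:
  fixes A :: "real mat"
  assumes A: "A \<in> carrier_mat N N" and l: "l < N" "v l \<noteq> 0"
    and eq: "\<And>k. k < N \<Longrightarrow> (\<Sum>l<N. A $$ (k, l) * v l) = 0"
  shows "Determinant.det A = 0"
proof -
  let ?v = "Matrix.vec N v"
  have "mult_mat_vec A ?v = 0\<^sub>v N"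
  proof (rule eq_vecI)
    fix k assume "k < dim_vec (0\<^sub>v N :: real Matrix.vec)"
    then have k: "k < N" by simp
    have "vec_index (mult_mat_vec A ?v) k = (\<Sum>l<N. A $$ (k, l) * v l)"
      using A k by (simp add: scalar_prod_def atLeast0LessThan)
    then show "vec_index (mult_mat_vec A ?v) k = vec_index (0\<^sub>v N) k"
      using eq[OF k] k by simp
  qed (use A in simp)
  moreover have "?v \<noteq> 0\<^sub>v N"
  proof
    assume "?v = 0\<^sub>v N"
    then have "vec_index ?v l = vec_index (0\<^sub>v N) l" by simp
    then show False using l by simp
  qed
  moreover have "?v \<in> carrier_vec N" by simp
  ultimately show ?thesis
    unfolding det_0_iff_vec_prod_zero[OF A] by (intro exI[of _ ?v] conjI)
qed

text \<open>The determinant of t - M(s) is taken as a polynomial in \<open>s\<close> over Z[t]. Each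
  of its entries has norm at most \<open>1 + E\<close>, and its leading coefficient in
  \<open>s\<close>, whose norm is no larger than that of the determinant, is a nonzero integer
  polynomial in \<open>t\<close> that vanishes at \<mu>.\<close>

theorem eigenvalue_limit_lower_bound:
  fixes M :: "nat \<Rightarrow> nat \<Rightarrow> int poly"
  assumes M: "\<And>k l. k < N \<Longrightarrow> l < N \<Longrightarrow> int_poly_norm (M k l) \<le> E" and E: "0 \<le> E"
    and s: "filterlim s at_top sequentially" and t: "t \<longlonglongrightarrow> \<mu>" and \<mu>: "0 < \<mu>"
    and l: "l < N" "\<And>j. v j l \<noteq> 0"
    and eq: "\<And>j k. k < N \<Longrightarrow> t j * v j k = (\<Sum>l<N. int_poly_eval (s j) (M k l) * v j l)"
  shows "1 / (fact N * (1 + E) ^ N) \<le> \<mu>"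
proof -
  \<comment> \<open>Embeds Z[s] into Z[t][s]: every integer coefficient becomes a constant
    polynomial in \<open>t\<close>.\<close>
  define c where "c = (\<lambda>q::int poly. map_poly (\<lambda>a. [:a:]) q)"
  define A where "A = Matrix.mat N N (\<lambda>(k, l). (if k = l then [:[:0, 1:]:] else 0) - c (M k l))"
  define q where "q = Determinant.det A"
  have A: "A \<in> carrier_mat N N" by (simp add: A_def)
  have c_norm: "int_poly2_norm (c q) = int_poly_norm q" for q
  proof (induction q)
    case (pCons a q)
    then show ?case by (simp add: c_def map_poly_pCons)
  qed (simp add: c_def)
  have c_eval: "int_poly2_eval x y (c q) = int_poly_eval x q" for x y q
  proof -
    have "map_poly (int_poly_eval y) (c q) = of_int_poly q"
      by (rule poly_eqI) (simp add: c_def coeff_map_poly int_poly_eval_sum)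
    then show ?thesis by (simp add: int_poly2_eval_def int_poly_eval_def)
  qed
  have entry: "int_poly2_norm (A $$ (k, l)) \<le> 1 + E" if "k < N" "l < N" for k l
  proof -
    have "int_poly2_norm (A $$ (k, l)) \<le> int_poly2_norm (if k = l then [:[:0, 1:]:] else 0) + int_poly2_norm (c (M k l))"
      using that by (simp add: A_def int_poly_poly.norm_diff)
    also have "\<dots> \<le> 1 + E"
      using that M by (intro add_mono) (auto simp: c_norm)
    finally show ?thesis .
  qed
  have norm: "int_poly2_norm q \<le> fact N * (1 + E) ^ N"
    unfolding q_def by (rule int_poly_poly.norm_det_le[OF A entry])
  \<comment> \<open>At \<open>s = 0\<close> the determinant specialises to the characteristic
    polynomial of the integer matrix M(0), which is monic in \<open>t\<close> and hence
    nonzero.\<close>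
  have nz: "q \<noteq> 0"
  proof
    assume 0: "q = 0"
    let ?M0 = "Matrix.mat N N (\<lambda>(k, l). coeff (M k l) 0)"
    have h: "comm_ring_hom (\<lambda>p::int poly poly. poly p 0)" by unfold_locales auto
    have "map_mat (\<lambda>p. poly p 0) A = char_poly_matrix ?M0"
    proof (rule eq_matI)
      fix k l assume "k < dim_row (char_poly_matrix ?M0)" "l < dim_col (char_poly_matrix ?M0)"
      then show "map_mat (\<lambda>p. poly p 0) A $$ (k, l) = char_poly_matrix ?M0 $$ (k, l)"
        by (auto simp: A_def char_poly_matrix_def c_def poly_0_coeff_0 coeff_map_poly)
    qed (auto simp: A_def char_poly_matrix_def)
    then have "char_poly ?M0 = poly q 0"
      unfolding char_poly_def q_def by (metis comm_ring_hom.hom_det[OF h])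
    moreover have "monic (char_poly ?M0)"
      using degree_monic_char_poly[of ?M0 N] by simp
    ultimately show False using 0 by simp
  qed
  have root: "int_poly2_eval (s j) (t j) q = 0" for j
  proof -
    interpret e: comm_ring_hom "int_poly2_eval (s j) (t j)" by (rule comm_ring_hom_int_poly2_eval)
    have "Determinant.det (map_mat (int_poly2_eval (s j) (t j)) A) = 0"
    proof (rule eigenvalue_det_eq_0[where v = "v j" and l = l and N = N])
      fix k assume k: "k < N"
      have x: "int_poly2_eval (s j) (t j) [:[:0, 1:]:] = t j"
        by (simp add: int_poly2_eval_def int_poly_eval_def map_poly_pCons)
      have "(\<Sum>l<N. map_mat (int_poly2_eval (s j) (t j)) A $$ (k, l) * v j l) =
          (\<Sum>l<N. (if k = l then t j else 0) * v j l - int_poly_eval (s j) (M k l) * v j l)"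
        using k by (intro sum.cong) (auto simp: A_def e.hom_minus x c_eval algebra_simps)
      also have "\<dots> = (\<Sum>l<N. (if k = l then t j * v j l else 0)) - t j * v j k"
        unfolding sum_subtractf eq[OF k] by (intro arg_cong2[where f = "(-)"] sum.cong) auto
      also have "\<dots> = 0" using k by simp
      finally show "(\<Sum>l<N. map_mat (int_poly2_eval (s j) (t j)) A $$ (k, l) * v j l) = 0" .
    qed (use A l in auto)
    then show ?thesis by (simp add: q_def)
  qed
  show ?thesis
  proof (rule root_lower_bound[OF _ root_at_infinity[OF s t root] \<mu>])
    show "lead_coeff q \<noteq> 0" using nz by simp
    show "int_poly_norm (lead_coeff q) \<le> fact N * (1 + E) ^ N"
      using int_poly.norm_coeff_le_poly_norm[of q "degree q"] norm by simp
    have "1 * 1 \<le> fact N * (1 + E) ^ N"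
      using E by (intro mult_mono one_le_power) (auto simp: fact_ge_1)
    then show "1 \<le> fact N * (1 + E) ^ N" by simp
  qed
qed

section \<open>Elimination: values of \<open>G\<close> at penalised minimisers as eigenvalues, and
  the minimum of \<open>G\<close> on a box\<close>

subsection \<open>Elimination by monomial reduction\<close>

lemma
  shows int_poly_eval_0 [simp]: "int_poly_eval s 0 = 0"
    and int_poly_eval_1 [simp]: "int_poly_eval s 1 = 1"
    and int_poly_eval_mult: "int_poly_eval s (p * q) = int_poly_eval s p * int_poly_eval s q"
    and int_poly_eval_hom_sum: "int_poly_eval s (\<Sum>j\<in>A. f j) = (\<Sum>j\<in>A. int_poly_eval s (f j))"
proof -
  interpret e: comm_ring_hom "int_poly_eval s" by (rule comm_ring_hom_int_poly_eval)
  show "int_poly_eval s 0 = 0" "int_poly_eval s 1 = 1"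
    "int_poly_eval s (p * q) = int_poly_eval s p * int_poly_eval s q"
    "int_poly_eval s (\<Sum>j\<in>A. f j) = (\<Sum>j\<in>A. int_poly_eval s (f j))"
    by (simp_all add: e.hom_mult e.hom_sum)
qed

text \<open>Replacing a factor \<open>x i ^ e\<close> by its relation lowers the total degree by at
  least 1 and costs at most a factor \<Gamma> in norm, so \<Gamma>^(degree) bounds the whole
  reduction. The set \<open>V\<close> makes the coefficients uniform: one choice of \<open>c\<close>
  serves all its points and all values of \<open>s\<close>.\<close>

lemma monomial_reduction:
  fixes h :: "nat \<Rightarrow> mindex \<Rightarrow> int poly" and V :: "(real \<times> (nat \<Rightarrow> real)) set"
  assumes e: "0 < e" and fin: "\<And>i. i < n \<Longrightarrow> finite (S i)"
    and deg: "\<And>i \<gamma>. i < n \<Longrightarrow> \<gamma> \<in> S i \<Longrightarrow> mdeg \<gamma> < e \<and> keys \<gamma> \<subseteq> {..<n}"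
    and norm: "\<And>i. i < n \<Longrightarrow> (\<Sum>\<gamma>\<in>S i. int_poly_norm (h i \<gamma>)) \<le> \<Gamma>" and \<Gamma>: "1 \<le> \<Gamma>"
    and V: "\<And>s x i. (s, x) \<in> V \<Longrightarrow> i < n \<Longrightarrow> x i ^ e = (\<Sum>\<gamma>\<in>S i. int_poly_eval s (h i \<gamma>) * meval x \<gamma>)"
    and \<beta>: "keys \<beta> \<subseteq> {..<n}"
  shows "\<exists>c. (\<Sum>\<alpha>\<in>bounded_mindex n e. int_poly_norm (c \<alpha>)) \<le> \<Gamma> ^ mdeg \<beta> \<and>
    (\<forall>s x. (s, x) \<in> V \<longrightarrow> meval x \<beta> = (\<Sum>\<alpha>\<in>bounded_mindex n e. int_poly_eval s (c \<alpha>) * meval x \<alpha>))"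
  using \<beta>
proof (induction "mdeg \<beta>" arbitrary: \<beta> rule: less_induct)
  case less
  let ?B = "bounded_mindex n e"
  show ?case
  proof (cases "\<beta> \<in> ?B")
    case True
    let ?c = "\<lambda>\<alpha>. if \<alpha> = \<beta> then 1 else 0 :: int poly"
    have "(\<Sum>\<alpha>\<in>?B. int_poly_norm (?c \<alpha>)) = (\<Sum>\<alpha>\<in>?B. if \<alpha> = \<beta> then 1 else 0)"
      by (rule sum.cong) (auto simp: one_pCons)
    also have "\<dots> = 1" using True by simp
    also have "\<dots> \<le> \<Gamma> ^ mdeg \<beta>" using \<Gamma> by (rule one_le_power)
    finally have 1: "(\<Sum>\<alpha>\<in>?B. int_poly_norm (?c \<alpha>)) \<le> \<Gamma> ^ mdeg \<beta>" .
    have 2: "(\<Sum>\<alpha>\<in>?B. int_poly_eval s (?c \<alpha>) * meval x \<alpha>) = meval x \<beta>" for s x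
    proof -
      have "(\<Sum>\<alpha>\<in>?B. int_poly_eval s (?c \<alpha>) * meval x \<alpha>) = (\<Sum>\<alpha>\<in>?B. if \<alpha> = \<beta> then meval x \<beta> else 0)"
        by (rule sum.cong) auto
      then show ?thesis using True by simp
    qed
    show ?thesis using 1 2 by (intro exI[of _ ?c]) simp
  next
    case False
    then obtain i where i: "e \<le> lookup \<beta> i"
      using less.prems by (auto simp: bounded_mindex_def not_less)
    with e have "i \<in> keys \<beta>" by (auto simp: in_keys_iff)
    with less.prems have iN: "i < n" by auto
    define \<delta> where "\<delta> = \<beta> - single i e"
    have \<beta>: "\<beta> = single i e + \<delta>" unfolding \<delta>_def by (rule mindex_split[OF i])
    have m\<beta>: "mdeg \<beta> = e + mdeg \<delta>" by (subst \<beta>) (simp add: mdeg_add)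
    have k\<delta>: "keys \<delta> \<subseteq> {..<n}"
      unfolding \<delta>_def using keys_minus_subset less.prems by blast
    have "\<exists>c. (\<Sum>\<alpha>\<in>?B. int_poly_norm (c \<alpha>)) \<le> \<Gamma> ^ mdeg (\<delta> + \<gamma>) \<and>
        (\<forall>s x. (s, x) \<in> V \<longrightarrow> meval x (\<delta> + \<gamma>) = (\<Sum>\<alpha>\<in>?B. int_poly_eval s (c \<alpha>) * meval x \<alpha>))" if "\<gamma> \<in> S i" for \<gamma>
    proof (rule less.hyps)
      show "mdeg (\<delta> + \<gamma>) < mdeg \<beta>" using deg[OF iN that] m\<beta> by (simp add: mdeg_add)
      show "keys (\<delta> + \<gamma>) \<subseteq> {..<n}" using keys_add[of \<delta> \<gamma>] deg[OF iN that] k\<delta> by blast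
    qed
    then have "\<exists>c. \<forall>\<gamma>\<in>S i. (\<Sum>\<alpha>\<in>?B. int_poly_norm (c \<gamma> \<alpha>)) \<le> \<Gamma> ^ mdeg (\<delta> + \<gamma>) \<and>
        (\<forall>s x. (s, x) \<in> V \<longrightarrow> meval x (\<delta> + \<gamma>) = (\<Sum>\<alpha>\<in>?B. int_poly_eval s (c \<gamma> \<alpha>) * meval x \<alpha>))"
      by (intro bchoice ballI)
    then obtain c where c: "\<And>\<gamma>. \<gamma> \<in> S i \<Longrightarrow> (\<Sum>\<alpha>\<in>?B. int_poly_norm (c \<gamma> \<alpha>)) \<le> \<Gamma> ^ mdeg (\<delta> + \<gamma>)"
      "\<And>\<gamma> s x. \<gamma> \<in> S i \<Longrightarrow> (s, x) \<in> V \<Longrightarrow> meval x (\<delta> + \<gamma>) = (\<Sum>\<alpha>\<in>?B. int_poly_eval s (c \<gamma> \<alpha>) * meval x \<alpha>)"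
      by blast
    let ?d = "\<lambda>\<alpha>. \<Sum>\<gamma>\<in>S i. h i \<gamma> * c \<gamma> \<alpha>"
    have "(\<Sum>\<alpha>\<in>?B. int_poly_norm (?d \<alpha>)) \<le> (\<Sum>\<alpha>\<in>?B. \<Sum>\<gamma>\<in>S i. int_poly_norm (h i \<gamma>) * int_poly_norm (c \<gamma> \<alpha>))"
      by (intro sum_mono order.trans[OF int_poly.norm_sum] int_poly.norm_mult)
    also have "\<dots> = (\<Sum>\<gamma>\<in>S i. int_poly_norm (h i \<gamma>) * (\<Sum>\<alpha>\<in>?B. int_poly_norm (c \<gamma> \<alpha>)))"
      by (subst sum.swap) (simp add: sum_distrib_left)
    \<comment> \<open>\<open>mdeg \<gamma> < e\<close> puts every rewritten monomial at degree at
      most \<open>mdeg \<beta> - 1\<close>; the missing power is supplied by the norm of the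
      relation itself.\<close>
    also have "\<dots> \<le> (\<Sum>\<gamma>\<in>S i. int_poly_norm (h i \<gamma>) * \<Gamma> ^ (mdeg \<beta> - 1))"
    proof (intro sum_mono mult_left_mono int_poly.norm_nonneg)
      fix \<gamma> assume g: "\<gamma> \<in> S i"
      have "\<Gamma> ^ mdeg (\<delta> + \<gamma>) \<le> \<Gamma> ^ (mdeg \<beta> - 1)"
        using deg[OF iN g] m\<beta> \<Gamma> by (intro power_increasing) (auto simp: mdeg_add)
      then show "(\<Sum>\<alpha>\<in>?B. int_poly_norm (c \<gamma> \<alpha>)) \<le> \<Gamma> ^ (mdeg \<beta> - 1)"
        using c(1)[OF g] by linarith
    qed
    also have "\<dots> \<le> \<Gamma> * \<Gamma> ^ (mdeg \<beta> - 1)"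
      unfolding sum_distrib_right[symmetric]
      using norm[OF iN] \<Gamma> by (intro mult_right_mono) auto
    also have "\<dots> = \<Gamma> ^ mdeg \<beta>" using m\<beta> e by (simp flip: power_Suc)
    finally have 1: "(\<Sum>\<alpha>\<in>?B. int_poly_norm (?d \<alpha>)) \<le> \<Gamma> ^ mdeg \<beta>" .
    have 2: "meval x \<beta> = (\<Sum>\<alpha>\<in>?B. int_poly_eval s (?d \<alpha>) * meval x \<alpha>)" if sx: "(s, x) \<in> V" for s x
    proof -
      have "meval x \<beta> = x i ^ e * meval x \<delta>" by (subst \<beta>) (simp add: meval_add)
      also have "\<dots> = (\<Sum>\<gamma>\<in>S i. int_poly_eval s (h i \<gamma>) * meval x (\<delta> + \<gamma>))"
        unfolding V[OF sx iN] sum_distrib_right meval_add by (simp add: mult_ac)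
      also have "\<dots> = (\<Sum>\<gamma>\<in>S i. \<Sum>\<alpha>\<in>?B. int_poly_eval s (h i \<gamma> * c \<gamma> \<alpha>) * meval x \<alpha>)"
        by (intro sum.cong refl) (simp only: c(2)[OF _ sx] sum_distrib_left int_poly_eval_mult mult.assoc)
      also have "\<dots> = (\<Sum>\<alpha>\<in>?B. int_poly_eval s (?d \<alpha>) * meval x \<alpha>)"
        by (subst sum.swap) (simp add: int_poly_eval_hom_sum sum_distrib_right)
      finally show ?thesis .
    qed
    show ?thesis using 1 2 by (intro exI[of _ ?d]) blast
  qed
qed

text \<open>At the points \<open>x j\<close>, \<open>G\<close> times each reduced monomial is a
  combination of reduced monomials over Z[s], with coefficients that do not depend on
  \<open>j\<close>. Thus the vector of monomial values is an eigenvector with eigenvalue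
  \<open>mpeval G (x j)\<close>. The exponent \<open>n * (e - 1) + D\<close> bounds the degree of a
  reduced monomial times a term of \<open>G\<close>.\<close>

lemma elimination_lower_bound:
  fixes h :: "nat \<Rightarrow> mindex \<Rightarrow> int poly" and x :: "nat \<Rightarrow> nat \<Rightarrow> real"
  assumes e: "0 < e" and fin: "\<And>i. i < n \<Longrightarrow> finite (S i)"
    and deg: "\<And>i \<gamma>. i < n \<Longrightarrow> \<gamma> \<in> S i \<Longrightarrow> mdeg \<gamma> < e \<and> keys \<gamma> \<subseteq> {..<n}"
    and norm: "\<And>i. i < n \<Longrightarrow> (\<Sum>\<gamma>\<in>S i. int_poly_norm (h i \<gamma>)) \<le> \<Gamma>" and \<Gamma>: "1 \<le> \<Gamma>"
    and V: "\<And>j i. i < n \<Longrightarrow> x j i ^ e = (\<Sum>\<gamma>\<in>S i. int_poly_eval (s j) (h i \<gamma>) * meval (x j) \<gamma>)"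
    and G: "int_coeffs G" "vars G \<subseteq> {..<n}" "total_degree G \<le> D"
    and s: "filterlim s at_top sequentially"
    and lim: "(\<lambda>j. mpeval G (x j)) \<longlonglongrightarrow> \<mu>" and \<mu>: "0 < \<mu>"
  shows "1 / (fact (e ^ n) * (1 + l1_norm G * \<Gamma> ^ (n * (e - 1) + D)) ^ (e ^ n)) \<le> \<mu>"
proof -
  let ?B = "bounded_mindex n e" and ?E = "l1_norm G * \<Gamma> ^ (n * (e - 1) + D)"
  define N where "N = card ?B"
  have N: "N \<le> e ^ n" by (simp add: N_def card_bounded_mindex_le)
  obtain idx where idx: "bij_betw idx {..<N} ?B"
    using ex_bij_betw_nat_finite[OF finite_bounded_mindex] by (auto simp: N_def atLeast0LessThan)
  have idxB: "idx k \<in> ?B" if "k < N" for k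
    using idx that by (auto simp: bij_betw_def)
  \<comment> \<open>The monomial 1 takes the value 1 everywhere; it keeps the eigenvector nonzero
    along the whole sequence, at a fixed index.\<close>
  have "0 \<in> ?B" using e by (simp add: bounded_mindex_def)
  then obtain l where l: "l < N" "idx l = 0"
    using idx by (metis bij_betw_def imageE lessThan_iff)
  have "\<exists>c. keys \<beta> \<subseteq> {..<n} \<longrightarrow> (\<Sum>\<alpha>\<in>?B. int_poly_norm (c \<alpha>)) \<le> \<Gamma> ^ mdeg \<beta> \<and>
    (\<forall>j. meval (x j) \<beta> = (\<Sum>\<alpha>\<in>?B. int_poly_eval (s j) (c \<alpha>) * meval (x j) \<alpha>))" for \<beta>
  proof (cases "keys \<beta> \<subseteq> {..<n}")
    case True
    have "\<exists>c. (\<Sum>\<alpha>\<in>?B. int_poly_norm (c \<alpha>)) \<le> \<Gamma> ^ mdeg \<beta> \<and>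
        (\<forall>s' x'. (s', x') \<in> range (\<lambda>j. (s j, x j)) \<longrightarrow>
          meval x' \<beta> = (\<Sum>\<alpha>\<in>?B. int_poly_eval s' (c \<alpha>) * meval x' \<alpha>))"
      by (rule monomial_reduction[where S = S and h = h]) (use e fin deg norm \<Gamma> V True in auto)
    then show ?thesis by blast
  qed auto
  then obtain c where c: "\<And>\<beta>. keys \<beta> \<subseteq> {..<n} \<Longrightarrow> (\<Sum>\<alpha>\<in>?B. int_poly_norm (c \<beta> \<alpha>)) \<le> \<Gamma> ^ mdeg \<beta>"
    "\<And>\<beta> j. keys \<beta> \<subseteq> {..<n} \<Longrightarrow> meval (x j) \<beta> = (\<Sum>\<alpha>\<in>?B. int_poly_eval (s j) (c \<beta> \<alpha>) * meval (x j) \<alpha>)"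
    by metis
  \<comment> \<open>Row \<open>k\<close> expands \<open>G\<close> times the \<open>k\<close>-th
    reduced monomial: each resulting monomial is reduced separately, and its coefficient at the
    \<open>l\<close>-th reduced monomial is collected.\<close>
  define M where "M = (\<lambda>k l. \<Sum>\<gamma>\<in>keys G. Polynomial.smult \<lfloor>lookup G \<gamma>\<rfloor> (c (\<gamma> + idx k) (idx l)))"
  have floor: "of_int \<lfloor>lookup G \<gamma>\<rfloor> = lookup G \<gamma>" for \<gamma>
    using G(1) by (simp add: int_coeffs_def)
  have keysB: "keys (\<gamma> + idx k) \<subseteq> {..<n}" if "\<gamma> \<in> keys G" "k < N" for \<gamma> k
    using keys_add[of \<gamma> "idx k"] that G(2) idxB[of k] by (auto simp: vars_def bounded_mindex_def)
  have degB: "mdeg (\<gamma> + idx k) \<le> n * (e - 1) + D" if "\<gamma> \<in> keys G" "k < N" for \<gamma> k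
  proof -
    have "mdeg (idx k) = (\<Sum>i<n. lookup (idx k) i)"
      using idxB[OF that(2)] by (intro mdeg_superset) (auto simp: bounded_mindex_def)
    also have "\<dots> \<le> (\<Sum>i<n. e - 1)"
    proof (rule sum_mono)
      fix i
      have "lookup (idx k) i < e" using idxB[OF that(2)] by (simp add: bounded_mindex_def)
      then show "lookup (idx k) i \<le> e - 1" by simp
    qed
    finally show ?thesis
      using G(3) mdeg_le_total_degree[OF that(1)] by (simp add: mdeg_add)
  qed
  have E0: "0 \<le> ?E" using \<Gamma> by simp
  have "1 / (fact N * (1 + ?E) ^ N) \<le> \<mu>"
  proof (rule eigenvalue_limit_lower_bound[where M = M and v = "\<lambda>j k. meval (x j) (idx k)" and l = l,
      OF _ E0 s lim \<mu> l(1)])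
    fix k l assume kl: "k < N" "l < N"
    have "int_poly_norm (M k l) \<le> (\<Sum>\<gamma>\<in>keys G. \<bar>lookup G \<gamma>\<bar> * int_poly_norm (c (\<gamma> + idx k) (idx l)))"
      unfolding M_def
      by (intro order.trans[OF int_poly.norm_sum] sum_mono order.trans[OF abs_int.poly_norm_smult])
         (simp add: floor)
    also have "\<dots> \<le> (\<Sum>\<gamma>\<in>keys G. \<bar>lookup G \<gamma>\<bar> * \<Gamma> ^ (n * (e - 1) + D))"
    proof (intro sum_mono mult_left_mono)
      fix \<gamma> assume g: "\<gamma> \<in> keys G"
      have "int_poly_norm (c (\<gamma> + idx k) (idx l)) \<le> (\<Sum>\<alpha>\<in>?B. int_poly_norm (c (\<gamma> + idx k) \<alpha>))"
        by (rule member_le_sum) (use idxB kl int_poly.norm_nonneg in auto)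
      also have "\<dots> \<le> \<Gamma> ^ mdeg (\<gamma> + idx k)" by (rule c(1)[OF keysB[OF g kl(1)]])
      also have "\<dots> \<le> \<Gamma> ^ (n * (e - 1) + D)"
        by (rule power_increasing[OF degB[OF g kl(1)] \<Gamma>])
      finally show "int_poly_norm (c (\<gamma> + idx k) (idx l)) \<le> \<Gamma> ^ (n * (e - 1) + D)" .
    qed auto
    also have "\<dots> = ?E" by (simp add: l1_norm_def sum_distrib_right)
    finally show "int_poly_norm (M k l) \<le> ?E" .
  next
    show "meval (x j) (idx l) \<noteq> 0" for j by (simp add: l)
  next
    fix j k assume k: "k < N"
    have "mpeval G (x j) * meval (x j) (idx k) = (\<Sum>\<gamma>\<in>keys G. lookup G \<gamma> * meval (x j) (\<gamma> + idx k))"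
      unfolding mpeval_meval sum_distrib_right meval_add by (simp only: mult_ac)
    also have "\<dots> = (\<Sum>\<gamma>\<in>keys G. \<Sum>\<alpha>\<in>?B. lookup G \<gamma> * int_poly_eval (s j) (c (\<gamma> + idx k) \<alpha>) * meval (x j) \<alpha>)"
      using c(2)[OF keysB[OF _ k]] by (intro sum.cong refl) (simp add: sum_distrib_left mult_ac)
    also have "\<dots> = (\<Sum>\<alpha>\<in>?B. \<Sum>\<gamma>\<in>keys G. lookup G \<gamma> * int_poly_eval (s j) (c (\<gamma> + idx k) \<alpha>) * meval (x j) \<alpha>)"
      by (rule sum.swap)
    also have "\<dots> = (\<Sum>l<N. \<Sum>\<gamma>\<in>keys G. lookup G \<gamma> * int_poly_eval (s j) (c (\<gamma> + idx k) (idx l)) * meval (x j) (idx l))"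
      by (rule sum.reindex_bij_betw[OF idx, symmetric])
    also have "\<dots> = (\<Sum>l<N. int_poly_eval (s j) (M k l) * meval (x j) (idx l))"
    proof (rule sum.cong[OF refl])
      fix l
      have smult: "int_poly_eval (s j) (Polynomial.smult a p) = of_int a * int_poly_eval (s j) p" for a p
        by (simp add: int_poly_eval_def of_int_hom.map_poly_hom_smult)
      show "(\<Sum>\<gamma>\<in>keys G. lookup G \<gamma> * int_poly_eval (s j) (c (\<gamma> + idx k) (idx l)) * meval (x j) (idx l)) =
          int_poly_eval (s j) (M k l) * meval (x j) (idx l)"
        unfolding M_def int_poly_eval_hom_sum smult floor by (simp add: sum_distrib_right)
    qed
    finally show "mpeval G (x j) * meval (x j) (idx k) = (\<Sum>l<N. int_poly_eval (s j) (M k l) * meval (x j) (idx l))" .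
  qed
  moreover have "fact N * (1 + ?E) ^ N \<le> fact (e ^ n) * (1 + ?E) ^ (e ^ n)"
    using E0 by (intro mult_mono fact_mono power_increasing N) auto
  moreover have "0 < fact N * (1 + ?E) ^ N" using E0 by (intro mult_pos_pos zero_less_power) auto
  ultimately show ?thesis
    by (meson divide_left_mono mult_pos_pos order.trans zero_le_one order_less_le_trans)
qed

subsection \<open>Positive polynomials on boxes\<close>

text \<open>Points are functions on all of \<open>nat\<close>, so coordinates from \<open>n\<close>
  on are pinned to 0; this makes the box a product of compact sets, and hence compact in the product
  topology.\<close>

definition coord_box :: "nat \<Rightarrow> (nat \<Rightarrow> real) \<Rightarrow> (nat \<Rightarrow> real) \<Rightarrow> (nat \<Rightarrow> real) set" where
  "coord_box n a b = {x. (\<forall>i<n. a i \<le> x i \<and> x i \<le> b i) \<and> (\<forall>i\<ge>n. x i = 0)}"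

lemma compact_coord_box: "compact (coord_box n a b)"
proof -
  let ?S = "\<lambda>i. if i < n then {a i..b i} else {0}"
  have "coord_box n a b = PiE UNIV ?S"
    by (auto simp: coord_box_def PiE_def Pi_def extensional_def not_less split: if_splits)
  moreover have "compactin (product_topology (\<lambda>i. euclidean) UNIV) (PiE UNIV ?S)"
    unfolding compactin_PiE by auto
  ultimately show ?thesis by (simp add: euclidean_product_topology)
qed

lemma continuous_on_mpeval: "continuous_on A (\<lambda>x. mpeval p x :: real)"
  unfolding mpeval_def
  by (intro continuous_intros continuous_on_subset[OF continuous_on_product_coordinates]) auto

text \<open>Multiplying the derivative of the penalised objective by \<open>(x\<^sub>i - a\<^sub>i) (x\<^sub>i - b\<^sub>i)\<close> treats all faces of the
  box at once, and the penalty makes \<open>x\<^sub>i ^ (m + 1)\<close> the only monomial of top degree.\<close>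

lemma box_minimizer_critical:
  fixes G :: "real mpoly"
  assumes x: "x \<in> coord_box n a b" and i: "i < n" and m: "0 < m"
    and min: "\<And>y. y \<in> coord_box n a b \<Longrightarrow>
      s * mpeval G x + (\<Sum>j<n. x j ^ m / m) \<le> s * mpeval G y + (\<Sum>j<n. y j ^ m / m)"
  shows "(x i - a i) * (x i - b i) * (s * mpeval (pdiff i G) x + x i ^ (m - 1)) = 0"
proof (cases "a i < x i \<and> x i < b i")
  case True
  let ?\<phi> = "\<lambda>t. s * mpeval G (x(i := t)) + (t ^ m / m + (\<Sum>j\<in>{..<n} - {i}. x j ^ m / m))"
  have eq: "(\<Sum>j<n. (x(i := t)) j ^ m / m) = t ^ m / m + (\<Sum>j\<in>{..<n} - {i}. x j ^ m / m)" for t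
  proof -
    have "(\<Sum>j<n. (x(i := t)) j ^ m / m) = (x(i := t)) i ^ m / m + (\<Sum>j\<in>{..<n} - {i}. (x(i := t)) j ^ m / m)"
      using i by (intro sum.remove) auto
    also have "(\<Sum>j\<in>{..<n} - {i}. (x(i := t)) j ^ m / m) = (\<Sum>j\<in>{..<n} - {i}. x j ^ m / m)"
      by (rule sum.cong) auto
    finally show ?thesis by (simp only: fun_upd_same)
  qed
  have der: "(?\<phi> has_real_derivative s * mpeval (pdiff i G) (x(i := x i)) + x i ^ (m - 1)) (at (x i))"
  proof -
    \<comment> \<open>Dividing the penalty by \<open>m\<close> gives its derivative the coefficient
      1, which later makes the relation for \<open>x i\<close> monic over the integers.\<close>
    have "((\<lambda>t. t ^ m / m) has_real_derivative x i ^ (m - 1)) (at (x i))"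
      using m by (auto intro!: derivative_eq_intros)
    from DERIV_add[OF DERIV_cmult[OF has_real_derivative_mpeval[of G x i "x i"], of s]
        DERIV_add[OF this DERIV_const[of "\<Sum>j\<in>{..<n} - {i}. x j ^ m / m"]]]
    show ?thesis by simp
  qed
  let ?d = "min (x i - a i) (b i - x i)"
  have "s * mpeval (pdiff i G) (x(i := x i)) + x i ^ (m - 1) = 0"
  proof (rule DERIV_local_min[OF der, of ?d])
    show "0 < ?d" using True by simp
    show "\<forall>y. \<bar>x i - y\<bar> < ?d \<longrightarrow> ?\<phi> (x i) \<le> ?\<phi> y"
    proof (intro allI impI)
      fix y assume y: "\<bar>x i - y\<bar> < ?d"
      have "x(i := y) \<in> coord_box n a b"
        using x y i by (auto simp: coord_box_def)
      from min[OF this] show "?\<phi> (x i) \<le> ?\<phi> y"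
        unfolding eq using eq[of "x i"] by simp
    qed
  qed
  then show ?thesis by simp
next
  case False
  then show ?thesis using x i by (auto simp: coord_box_def)
qed

text \<open>\<Gamma> bounds the norm of the relation for \<open>x i ^ (D + 3)\<close>:
  \<open>2 * B + B\<^sup>2\<close> accounts for the part free of \<open>s\<close>, and the remaining
  summand for the coefficient of \<open>s\<close>, where \<open>(1 + B)\<^sup>2\<close> comes from
  the boundary factor and \<open>D * \<Lambda>\<close> from a partial derivative of
  \<open>G\<close>.\<close>

theorem positive_on_box_lower_bound:
  fixes G :: "real mpoly"
  assumes ab: "\<And>i. i < n \<Longrightarrow> a i \<in> \<int> \<and> b i \<in> \<int> \<and> a i \<le> b i \<and> \<bar>a i\<bar> \<le> B \<and> \<bar>b i\<bar> \<le> B" and B: "1 \<le> B"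
    and G: "int_coeffs G" "vars G \<subseteq> {..<n}" "total_degree G \<le> D" "l1_norm G \<le> \<Lambda>"
    and pos: "\<And>x. 0 < mpeval G x"
    and y: "\<And>i. i < n \<Longrightarrow> a i \<le> y i \<and> y i \<le> b i"
  defines "\<Gamma> \<equiv> 2 * B + B\<^sup>2 + (1 + B)\<^sup>2 * (D * \<Lambda>)"
  shows "1 / (fact ((D + 3) ^ n) * (1 + \<Lambda> * \<Gamma> ^ (n * (D + 2) + D)) ^ ((D + 3) ^ n)) \<le> mpeval G y"
proof -
  \<comment> \<open>The degree bound for \<open>pdiff\<close> records no drop, so the boundary
    factor times a partial derivative of \<open>G\<close> is only known to have degree at most
    \<open>D + 2\<close>. The pure power \<open>?e = ?m + 1\<close> has to exceed this.\<close>
  let ?K = "coord_box n a b" and ?m = "D + 2" and ?e = "D + 3"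
  let ?R = "\<lambda>x::nat \<Rightarrow> real. \<Sum>j<n. x j ^ ?m / ?m"
  have \<Lambda>: "0 \<le> \<Lambda>" using G(4) l1_norm_nonneg[of G] by linarith
  have \<Gamma>: "1 \<le> \<Gamma>"
  proof -
    have "0 \<le> B\<^sup>2 + (1 + B)\<^sup>2 * (D * \<Lambda>)" using \<Lambda> by simp
    then show ?thesis using B unfolding \<Gamma>_def by linarith
  qed
  have K0: "(\<lambda>i. if i < n then a i else 0) \<in> ?K"
    using ab by (auto simp: coord_box_def)
  have contR: "continuous_on ?K ?R"
    by (intro continuous_intros continuous_on_subset[OF continuous_on_product_coordinates]) auto
  obtain z where z: "z \<in> ?K" "\<And>x. x \<in> ?K \<Longrightarrow> mpeval G z \<le> mpeval G x"
    using continuous_attains_inf[OF compact_coord_box _ continuous_on_mpeval[of ?K G]] K0 by blast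
  define s where "s = (\<lambda>j. 1 + real j)"
  have "\<exists>x\<in>?K. \<forall>w\<in>?K. s j * mpeval G x + ?R x \<le> s j * mpeval G w + ?R w" for j
    by (rule continuous_attains_inf[OF compact_coord_box])
       (use K0 in blast, intro continuous_on_add continuous_on_mult_left continuous_on_mpeval contR)
  then obtain x where x: "\<And>j. x j \<in> ?K"
    "\<And>j w. w \<in> ?K \<Longrightarrow> s j * mpeval G (x j) + ?R (x j) \<le> s j * mpeval G w + ?R w"
    by metis
  define C where "C = real n * B ^ ?m"
  have R: "\<bar>?R w\<bar> \<le> C" if "w \<in> ?K" for w
  proof -
    have "\<bar>?R w\<bar> \<le> (\<Sum>j<n. B ^ ?m)"
    proof (intro order.trans[OF sum_abs] sum_mono)
      fix j assume j: "j \<in> {..<n}"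
      have "\<bar>w j\<bar> \<le> B" using that ab[of j] j by (auto simp: coord_box_def)
      then have "\<bar>w j\<bar> ^ ?m \<le> B ^ ?m" by (intro power_mono) auto
      moreover have "\<bar>w j\<bar> ^ ?m / ?m \<le> \<bar>w j\<bar> ^ ?m / 1" by (intro divide_left_mono) auto
      ultimately show "\<bar>w j ^ ?m / ?m\<bar> \<le> B ^ ?m" 
        unfolding abs_divide power_abs by linarith
    qed
    then show ?thesis by (simp add: C_def)
  qed
  \<comment> \<open>Compare the penalised objective at \<open>x j\<close> and at the true minimiser
    \<open>z\<close>: the penalty is at most \<open>C\<close> in absolute value on the box, so the
    values of \<open>G\<close> differ by at most \<open>2 * C / s j\<close>.\<close>
  have lim: "(\<lambda>j. mpeval G (x j)) \<longlonglongrightarrow> mpeval G z"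
  proof (rule tendsto_sandwich)
    show "\<forall>\<^sub>F j in sequentially. mpeval G z \<le> mpeval G (x j)" using z x by simp
    show "\<forall>\<^sub>F j in sequentially. mpeval G (x j) \<le> mpeval G z + 2 * C * inverse (real (Suc j))"
    proof (rule always_eventually, rule allI)
      fix j
      have "s j * mpeval G (x j) + ?R (x j) \<le> s j * mpeval G z + ?R z" by (rule x(2)[OF z(1)])
      moreover have "?R z \<le> C" "- C \<le> ?R (x j)" using R[OF z(1)] R[OF x(1)[of j]] by linarith+
      ultimately have "s j * mpeval G (x j) \<le> s j * mpeval G z + 2 * C" by linarith
      then show "mpeval G (x j) \<le> mpeval G z + 2 * C * inverse (real (Suc j))"
        by (simp add: s_def field_simps)
    qed
    have "(\<lambda>j. mpeval G z + 2 * C * inverse (real (Suc j))) \<longlonglongrightarrow> mpeval G z + 2 * C * 0"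
      by (intro tendsto_add tendsto_mult tendsto_const LIMSEQ_inverse_real_of_nat)
    then show "(\<lambda>j. mpeval G z + 2 * C * inverse (real (Suc j))) \<longlonglongrightarrow> mpeval G z" by simp
  qed auto
  \<comment> \<open>The boundary factor \<open>(x i - a i) * (x i - b i)\<close>. Solving the
    critical equation for \<open>x i ^ (m + 1)\<close> gives \<open>P i + s * Q i\<close>, where
    \<open>P i\<close> collects the lower penalty terms and \<open>Q i\<close> the contribution of
    \<open>G\<close>.\<close>
  define q where "q = (\<lambda>i. single (single i 2) 1 + single (single i 1) (- (a i + b i)) + single 0 (a i * b i) :: real mpoly)"
  define P where "P = (\<lambda>i. single (single i ?m) (a i + b i) + single (single i (D + 1)) (- (a i * b i)) :: real mpoly)"
  define Q where "Q = (\<lambda>i. - (q i * pdiff i G))"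
  have q: "int_coeffs (q i)" "total_degree (q i) \<le> 2" "vars (q i) \<subseteq> {..<n}" "l1_norm (q i) \<le> (1 + B)\<^sup>2" if "i < n" for i
  proof -
    show "int_coeffs (q i)" unfolding q_def using ab[OF that] by (intro int_coeffs_add int_coeffs_single) auto
    show "total_degree (q i) \<le> 2" unfolding q_def by (intro total_degree_add_le total_degree_single_le) auto
    show "vars (q i) \<subseteq> {..<n}" unfolding q_def using that by (intro vars_add_subset vars_single_subset) auto
    have "l1_norm (q i) \<le> 1 + \<bar>a i + b i\<bar> + \<bar>a i * b i\<bar>"
      unfolding q_def by (intro order.trans[OF l1_norm_add] add_mono) simp_all
    also have "\<bar>a i * b i\<bar> \<le> B * B" unfolding abs_mult using ab[OF that] by (intro mult_mono) auto
    also have "\<bar>a i + b i\<bar> \<le> 2 * B" using ab[OF that] by linarith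
    finally show "l1_norm (q i) \<le> (1 + B)\<^sup>2"
      by (simp add: power2_eq_square algebra_simps)
  qed
  have P: "int_coeffs (P i)" "total_degree (P i) \<le> ?m" "vars (P i) \<subseteq> {..<n}" "l1_norm (P i) \<le> 2 * B + B\<^sup>2" if "i < n" for i
  proof -
    show "int_coeffs (P i)" unfolding P_def using ab[OF that] by (intro int_coeffs_add int_coeffs_single) auto
    show "total_degree (P i) \<le> ?m" unfolding P_def by (intro total_degree_add_le total_degree_single_le) auto
    show "vars (P i) \<subseteq> {..<n}" unfolding P_def using that by (intro vars_add_subset vars_single_subset) auto
    have "l1_norm (P i) \<le> \<bar>a i + b i\<bar> + \<bar>a i * b i\<bar>"
      unfolding P_def by (intro order.trans[OF l1_norm_add] add_mono) simp_all
    also have "\<bar>a i * b i\<bar> \<le> B * B" unfolding abs_mult using ab[OF that] by (intro mult_mono) auto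
    also have "\<bar>a i + b i\<bar> \<le> 2 * B" using ab[OF that] by linarith
    finally show "l1_norm (P i) \<le> 2 * B + B\<^sup>2"
      by (simp add: power2_eq_square)
  qed
  have Q: "int_coeffs (Q i)" "total_degree (Q i) \<le> ?m" "vars (Q i) \<subseteq> {..<n}" "l1_norm (Q i) \<le> (1 + B)\<^sup>2 * (D * \<Lambda>)" if "i < n" for i
  proof -
    show "int_coeffs (Q i)" unfolding Q_def using q[OF that] G by (intro int_coeffs_uminus int_coeffs_mult int_coeffs_pdiff)
    have "total_degree (q i * pdiff i G) \<le> 2 + D"
      using q[OF that] G total_degree_pdiff_le[of i G] by (intro total_degree_mult_le) auto
    then show "total_degree (Q i) \<le> ?m" unfolding Q_def by simp
    show "vars (Q i) \<subseteq> {..<n}" unfolding Q_def vars_uminus using q[OF that] G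
      by (intro vars_mult_subset vars_pdiff_subset)
    have "l1_norm (pdiff i G) \<le> D * \<Lambda>"
      using l1_norm_pdiff_le[OF G(3), of i] G(4) by (meson mult_left_mono of_nat_0_le_iff order.trans)
    then show "l1_norm (Q i) \<le> (1 + B)\<^sup>2 * (D * \<Lambda>)"
      unfolding Q_def l1_norm_uminus using q[OF that]
      by (intro order.trans[OF l1_norm_mult] mult_mono) auto
  qed
  define S where "S = (\<lambda>i. keys (P i) \<union> keys (Q i))"
  \<comment> \<open>The relation is linear in \<open>s\<close>, so each coefficient is a linear
    polynomial in \<open>s\<close>; the floors are exact by integrality.\<close>
  define h where "h = (\<lambda>i \<gamma>. [:\<lfloor>lookup (P i) \<gamma>\<rfloor>, \<lfloor>lookup (Q i) \<gamma>\<rfloor>:])"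
  have floor: "of_int \<lfloor>lookup (P i) \<gamma>\<rfloor> = lookup (P i) \<gamma>" "of_int \<lfloor>lookup (Q i) \<gamma>\<rfloor> = lookup (Q i) \<gamma>" if "i < n" for i \<gamma>
    using P(1)[OF that] Q(1)[OF that] by (simp_all add: int_coeffs_def)
  have h_eval: "int_poly_eval t (h i \<gamma>) = lookup (P i) \<gamma> + t * lookup (Q i) \<gamma>" if "i < n" for t i \<gamma>
  proof -
    have "int_poly_eval t (h i \<gamma>) = of_int \<lfloor>lookup (P i) \<gamma>\<rfloor> + t * of_int \<lfloor>lookup (Q i) \<gamma>\<rfloor>"
      by (simp add: h_def int_poly_eval_def of_int_hom.map_poly_pCons_hom)
    then show ?thesis by (simp only: floor[OF that])
  qed
  have "1 / (fact (?e ^ n) * (1 + l1_norm G * \<Gamma> ^ (n * (?e - 1) + D)) ^ (?e ^ n)) \<le> mpeval G z"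
  proof (rule elimination_lower_bound[where S = S and h = h and x = x and s = s, OF _ _ _ _ \<Gamma> _ G(1-3) _ lim pos])
    show "finite (S i)" for i by (simp add: S_def)
    show "filterlim s at_top sequentially"
      unfolding s_def by (rule filterlim_tendsto_add_at_top[OF tendsto_const filterlim_real_sequentially])
  next
    fix i \<gamma> assume i: "i < n" and g: "\<gamma> \<in> S i"
    have "mdeg \<gamma> \<le> ?m"
      using g P(2)[OF i] Q(2)[OF i] unfolding S_def total_degree_le_iff by blast
    moreover have "keys \<gamma> \<subseteq> {..<n}"
      using g P(3)[OF i] Q(3)[OF i] unfolding S_def vars_def by blast
    ultimately show "mdeg \<gamma> < ?e \<and> keys \<gamma> \<subseteq> {..<n}" by simp
  next
    fix i assume i: "i < n"
    have "(\<Sum>\<gamma>\<in>S i. int_poly_norm (h i \<gamma>)) = (\<Sum>\<gamma>\<in>S i. \<bar>lookup (P i) \<gamma>\<bar> + \<bar>lookup (Q i) \<gamma>\<bar>)"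
      by (rule sum.cong) (simp_all add: h_def floor[OF i])
    also have "\<dots> = l1_norm (P i) + l1_norm (Q i)"
      by (simp add: sum.distrib S_def l1_norm_superset[of "keys (P i) \<union> keys (Q i)"])
    also have "\<dots> \<le> \<Gamma>" unfolding \<Gamma>_def using P(4)[OF i] Q(4)[OF i] by linarith
    finally show "(\<Sum>\<gamma>\<in>S i. int_poly_norm (h i \<gamma>)) \<le> \<Gamma>" .
  next
    fix j i assume i: "i < n"
    let ?x = "x j" and ?g = "mpeval (pdiff i G) (x j)"
    have "(?x i - a i) * (?x i - b i) * (s j * ?g + ?x i ^ (?m - 1)) = 0"
      by (rule box_minimizer_critical[OF x(1) i]) (use x(2)[of _ j] in auto)
    then have "?x i ^ ?e = (a i + b i) * ?x i ^ ?m - a i * b i * ?x i ^ (D + 1)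
        + s j * (- ((?x i ^ 2 - (a i + b i) * ?x i + a i * b i) * ?g))"
      by (simp add: algebra_simps power2_eq_square eval_nat_numeral)
    also have "\<dots> = mpeval (P i) ?x + s j * mpeval (Q i) ?x"
    proof -
      have q: "mpeval (q i) ?x = ?x i ^ 2 - (a i + b i) * ?x i + a i * b i"
        by (simp add: q_def algebra_simps)
      have "mpeval (P i) ?x = (a i + b i) * ?x i ^ ?m - a i * b i * ?x i ^ (D + 1)"
        by (simp add: P_def)
      then show ?thesis by (simp only: Q_def mpeval_uminus mpeval_mult q)
    qed
    also have "\<dots> = (\<Sum>\<gamma>\<in>S i. lookup (P i) \<gamma> * meval ?x \<gamma>) + s j * (\<Sum>\<gamma>\<in>S i. lookup (Q i) \<gamma> * meval ?x \<gamma>)"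
      by (simp add: S_def mpeval_superset[of "keys (P i) \<union> keys (Q i)"])
    also have "\<dots> = (\<Sum>\<gamma>\<in>S i. int_poly_eval (s j) (h i \<gamma>) * meval ?x \<gamma>)"
      unfolding h_eval[OF i] by (simp add: sum_distrib_left sum.distrib algebra_simps)
    finally show "?x i ^ ?e = (\<Sum>\<gamma>\<in>S i. int_poly_eval (s j) (h i \<gamma>) * meval ?x \<gamma>)" .
  qed auto
  moreover have "mpeval G z \<le> mpeval G y"
  proof -
    \<comment> \<open>Pinning the coordinates from \<open>n\<close> on to 0 puts the point into
      \<open>coord_box\<close> without changing the value of \<open>G\<close>.\<close>
    let ?y = "\<lambda>i. if i < n then y i else 0"
    have "mpeval G z \<le> mpeval G ?y" using y by (intro z(2)) (auto simp: coord_box_def)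
    also have "\<dots> = mpeval G y" using G(2) by (intro mpeval_cong) auto
    finally show ?thesis .
  qed
  moreover have "1 / (fact (?e ^ n) * (1 + \<Lambda> * \<Gamma> ^ (n * (D + 2) + D)) ^ (?e ^ n)) \<le>
      1 / (fact (?e ^ n) * (1 + l1_norm G * \<Gamma> ^ (n * (?e - 1) + D)) ^ (?e ^ n))"
  proof -
    have l: "l1_norm G * \<Gamma> ^ (n * (D + 2) + D) \<le> \<Lambda> * \<Gamma> ^ (n * (D + 2) + D)"
      using G(4) \<Gamma> by (intro mult_right_mono) auto
    have 0: "0 \<le> l1_norm G * \<Gamma> ^ (n * (D + 2) + D)" using \<Gamma> by simp
    show ?thesis
      using l 0 \<Lambda> \<Gamma> by (intro divide_left_mono mult_left_mono power_mono mult_pos_pos zero_less_power) 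
        (auto intro!: add_pos_nonneg)
  qed
  ultimately show ?thesis by linarith
qed

section \<open>Explicit constants and the final count\<close>

subsection \<open>Size estimates\<close>

lemma l1_norm_le_card:
  assumes "vars p \<subseteq> {..<n}" "total_degree p \<le> d" "\<And>\<alpha>. \<alpha> \<in> keys p \<Longrightarrow> \<bar>lookup p \<alpha>\<bar> \<le> H" "0 \<le> H"
  shows "l1_norm p \<le> (real d + 1) ^ n * H"
proof -
  have "keys p \<subseteq> bounded_mindex n (d + 1)"
  proof
    fix \<alpha> assume a: "\<alpha> \<in> keys p"
    have "lookup \<alpha> i < d + 1" for i
      using lookup_le_mdeg[of \<alpha> i] mdeg_le_total_degree[OF a] assms(2) by linarith
    then show "\<alpha> \<in> bounded_mindex n (d + 1)"
      using assms(1) a by (auto simp: bounded_mindex_def vars_def)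
  qed
  then have "card (keys p) \<le> (d + 1) ^ n"
    using card_mono[OF finite_bounded_mindex] card_bounded_mindex_le order.trans by blast
  then have "real (card (keys p)) \<le> real ((d + 1) ^ n)" by (simp only: of_nat_le_iff)
  then have c: "real (card (keys p)) \<le> (real d + 1) ^ n" by (simp add: add.commute)
  have "l1_norm p \<le> real (card (keys p)) * H"
    unfolding l1_norm_def using sum_mono[of "keys p" "\<lambda>\<alpha>. \<bar>lookup p \<alpha>\<bar>" "\<lambda>_. H"] assms(3) by simp
  also have "\<dots> \<le> (real d + 1) ^ n * H" using c assms(4) by (rule mult_right_mono)
  finally show ?thesis .
qed

text \<open>Here 1/M is the lower bound for \<open>G\<close> on the box, \<open>K\<close> the factor
  in the upper bound \<open>width J * K\<close> for \<open>G\<close> at the midpoint of a failed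
  cube, and \<open>4 * H * K * M\<close> the bound for the ratio of side lengths in the count. In
  logarithms, \<Lambda> and \<Gamma> cost O(n X), a matrix entry O(n^2 d X), and the determinant
  multiplies this by its size; the dimension in the volume count supplies the third factor
  n.\<close>

lemma log_size_bound:
  fixes n d :: nat and H :: real
  assumes n: "1 \<le> n" and d: "1 \<le> d" and H: "1 \<le> H"
  defines "X \<equiv> real d + log 2 H + real n * log 2 (real d)"
  defines "\<Lambda> \<equiv> (1 + real n * (real d)\<^sup>2) * ((real d + 1) ^ n * H)\<^sup>2"
  defines "\<Gamma> \<equiv> 2 * H + H\<^sup>2 + (1 + H)\<^sup>2 * (real (2 * d) * \<Lambda>)"
  defines "M \<equiv> fact ((2 * d + 3) ^ n) * (1 + \<Lambda> * \<Gamma> ^ (n * (2 * d + 2) + 2 * d)) ^ ((2 * d + 3) ^ n)"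
  defines "K \<equiv> (2 * real d + 1) ^ (2 * n) * (2 * real d) ^ (2 * d) * \<Lambda> * H ^ (2 * d)"
  shows "1 \<le> M" "1 \<le> K"
    and "2 * (4 * H * K * M) ^ n \<le> 2 powr (150 * (real n ^ 3 * 2 ^ (24 * n) * real d ^ (12 * n + 1) * X))"
proof -
  let ?L = "log 2 :: real \<Rightarrow> real"
  let ?N = "(2 * d + 3) ^ n"
  have dr: "1 \<le> real d" and nr: "1 \<le> real n" using n d by auto
  have ld: "0 \<le> ?L (real d)" and lH: "0 \<le> ?L H" using dr H by auto
  have nld: "?L (real d) \<le> real n * ?L (real d)" using mult_right_mono[OF nr ld] by simp
  have X: "1 \<le> X" "real d \<le> X" "?L H \<le> X" "real n * ?L (real d) \<le> X" "?L (real d) \<le> X"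
    unfolding X_def using dr ld lH nld by linarith+
  have nX: "real n \<le> real n * X" "X \<le> real n * X" "1 \<le> real n * X"
    using mult_left_mono[OF X(1), of "real n"] mult_right_mono[OF nr, of X] mult_mono[OF nr X(1)] X nr by auto
  have dX: "X \<le> real d * X" using mult_right_mono[OF dr, of X] X by simp
  have ndX: "real n * X \<le> real n * real d * X"
    using mult_left_mono[OF dX, of "real n"] by (simp add: mult.assoc)
  have "real n \<le> 2 ^ n" using less_exp[of n] by (metis less_imp_le of_nat_le_iff of_nat_numeral of_nat_power)
  then have "?L (real n) \<le> ?L (2 ^ n)" using nr by (subst log_le_cancel_iff) auto
  then have ln: "?L (real n) \<le> real n" by (simp add: log_nat_power)
  have b1: "?L (1 + real n * (real d)\<^sup>2) \<le> 1 + real n + 2 * X"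
  proof -
    have "1 \<le> real n * (real d)\<^sup>2" using mult_mono[OF nr one_le_power[OF dr, of 2]] by simp
    then have "?L (1 + real n * (real d)\<^sup>2) \<le> ?L (2 * (real n * (real d)\<^sup>2))"
      by (subst log_le_cancel_iff) auto
    also have "\<dots> = 1 + ?L (real n) + 2 * ?L (real d)"
      using nr dr by (simp add: log_mult log_nat_power)
    finally show ?thesis using ln X by linarith
  qed
  have ld1: "?L (c * real d) = ?L c + ?L (real d)" if "0 < c" for c
    using that dr by (simp add: log_mult)
  have l8: "?L 2 = 1" "?L 4 = 2" "?L 8 = 3" "?L 16 = 4"
    using log_pow_cancel[of 2 2] log_pow_cancel[of 2 3] log_pow_cancel[of 2 4] by simp_all
  have b2: "?L (real d + 1) \<le> 1 + ?L (real d)"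
  proof -
    have "?L (real d + 1) \<le> ?L (2 * real d)" using dr by (subst log_le_cancel_iff) auto
    then show ?thesis by (simp add: ld1 l8)
  qed
  have p0: "0 < 1 + real n * (real d)\<^sup>2" by (simp add: add_pos_nonneg)
  have p1: "0 < (real d + 1) ^ n" by simp
  have \<Lambda>: "1 \<le> \<Lambda>"
  proof -
    have "1 * 1 \<le> (real d + 1) ^ n * H" using dr H by (intro mult_mono one_le_power) auto
    then have "1 \<le> ((real d + 1) ^ n * H)\<^sup>2" by (intro one_le_power) simp
    then have "1 * 1 \<le> \<Lambda>" unfolding \<Lambda>_def by (intro mult_mono) auto
    then show ?thesis by simp
  qed
  have L\<Lambda>: "?L \<Lambda> \<le> 10 * (real n * X)"
  proof -
    have "?L \<Lambda> = ?L (1 + real n * (real d)\<^sup>2) + 2 * (real n * ?L (real d + 1) + ?L H)"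
      unfolding \<Lambda>_def using p0 p1 H by (simp add: log_mult log_nat_power)
    also have "real n * ?L (real d + 1) \<le> real n * (1 + ?L (real d))"
      by (intro mult_left_mono b2) simp
    finally have "?L \<Lambda> \<le> ?L (1 + real n * (real d)\<^sup>2) + 2 * (real n + real n * ?L (real d) + ?L H)"
      by (simp add: algebra_simps)
    then show ?thesis using b1 X(3,4) nX by argo
  qed
  have HH: "H \<le> H\<^sup>2" "0 < H\<^sup>2" using H by (simp_all add: power2_eq_square)
  have d\<Lambda>: "\<Lambda> \<le> real d * \<Lambda>" "1 \<le> real d * \<Lambda>"
    using mult_right_mono[OF dr, of \<Lambda>] mult_mono[OF dr \<Lambda>] \<Lambda> by auto
  have \<Gamma>le: "\<Gamma> \<le> 16 * (real d * (H\<^sup>2 * \<Lambda>))"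
  proof -
    have "(1 + H)\<^sup>2 \<le> 4 * H\<^sup>2" using power_mono[of "1 + H" "2 * H" 2] H by (simp add: power_mult_distrib)
    then have "(1 + H)\<^sup>2 * (real (2 * d) * \<Lambda>) \<le> 4 * H\<^sup>2 * (real (2 * d) * \<Lambda>)"
      using \<Lambda> by (intro mult_right_mono) auto
    moreover have "H\<^sup>2 * 1 \<le> H\<^sup>2 * (real d * \<Lambda>)"
      using d\<Lambda> by (intro mult_left_mono) auto
    then have "2 * H + H\<^sup>2 \<le> 3 * (H\<^sup>2 * (real d * \<Lambda>))"
      using HH by linarith
    moreover have "0 \<le> H\<^sup>2 * (real d * \<Lambda>)" using HH d\<Lambda> by simp
    ultimately show ?thesis unfolding \<Gamma>_def by (simp add: algebra_simps)
  qed
  have \<Gamma>\<Lambda>: "\<Lambda> \<le> \<Gamma>"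
  proof -
    have "1 * (1 * \<Lambda>) \<le> (1 + H)\<^sup>2 * (real (2 * d) * \<Lambda>)"
      using H dr \<Lambda> by (intro mult_mono one_le_power) auto
    then show ?thesis unfolding \<Gamma>_def using H HH by linarith
  qed
  have \<Gamma>: "1 \<le> \<Gamma>" using \<Gamma>\<Lambda> \<Lambda> by linarith
  have L\<Gamma>: "?L \<Gamma> \<le> 17 * (real n * X)"
  proof -
    have "?L \<Gamma> \<le> ?L (16 * (real d * (H\<^sup>2 * \<Lambda>)))"
      using \<Gamma> \<Gamma>le by (subst log_le_cancel_iff) auto
    also have "\<dots> = 4 + ?L (real d) + 2 * ?L H + ?L \<Lambda>"
      using dr H \<Lambda> by (simp add: log_mult log_nat_power l8)
    finally show ?thesis using L\<Lambda> X nX by linarith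
  qed
  let ?D = "n * (2 * d + 2) + 2 * d"
  have nd: "1 \<le> real n * real d" "real n \<le> real n * real d" "real d \<le> real n * real d"
    using mult_mono[OF nr dr] mult_left_mono[OF dr, of "real n"] mult_right_mono[OF nr, of "real d"] by auto
  have D: "real (Suc ?D) \<le> 7 * (real n * real d)"
    using nd by (simp add: algebra_simps)
  \<comment> \<open>Common scale n^2 d X for the logarithms: one factor n comes from log \<Gamma>,
    and n d from the exponent of \<Gamma>.\<close>
  define Y where "Y = real n * (real n * real d * X)"
  have Y: "real n * X \<le> Y" "real n * real d * X \<le> Y" "1 \<le> Y"
  proof -
    have "0 \<le> real n * real d * X" using X by simp
    from mult_right_mono[OF nr this] show 1: "real n * real d * X \<le> Y" by (simp add: Y_def)
    then show "real n * X \<le> Y" "1 \<le> Y" using ndX nX by linarith+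
  qed
  have E: "1 \<le> 1 + \<Lambda> * \<Gamma> ^ ?D" using \<Lambda> \<Gamma> by simp
  have LE: "?L (1 + \<Lambda> * \<Gamma> ^ ?D) \<le> 120 * Y"
  proof -
    have "\<Lambda> * \<Gamma> ^ ?D \<le> \<Gamma> ^ Suc ?D"
      unfolding power_Suc using \<Gamma>\<Lambda> \<Gamma> by (intro mult_right_mono) auto
    moreover have "1 \<le> \<Gamma> ^ Suc ?D" using \<Gamma> by (rule one_le_power)
    ultimately have "1 + \<Lambda> * \<Gamma> ^ ?D \<le> 2 * \<Gamma> ^ Suc ?D" by linarith
    then have "?L (1 + \<Lambda> * \<Gamma> ^ ?D) \<le> ?L (2 * \<Gamma> ^ Suc ?D)"
      using E by (subst log_le_cancel_iff) auto
    also have "\<dots> = 1 + real (Suc ?D) * ?L \<Gamma>"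
      using \<Gamma> by (simp add: log_mult log_nat_power l8 del: power_Suc)
    also have "real (Suc ?D) * ?L \<Gamma> \<le> (7 * (real n * real d)) * (17 * (real n * X))"
      using D L\<Gamma> \<Gamma> by (intro mult_mono) auto
    also have "\<dots> = 119 * Y" by (simp add: Y_def)
    finally show ?thesis using Y by linarith
  qed
  have N1: "1 \<le> real ?N" by simp
  have LN: "?L (real ?N) \<le> 4 * Y"
  proof -
    have "?L (real ?N) = real n * ?L (2 * real d + 3)" by (simp add: log_nat_power)
    also have "\<dots> \<le> real n * (3 + ?L (real d))"
    proof (rule mult_left_mono)
      have "?L (2 * real d + 3) \<le> ?L (8 * real d)" using dr by (subst log_le_cancel_iff) auto
      then show "?L (2 * real d + 3) \<le> 3 + ?L (real d)" by (simp add: ld1 l8)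
    qed simp
    finally have "?L (real ?N) \<le> 3 * real n + real n * ?L (real d)"
      using nr by (simp add: algebra_simps)
    then show ?thesis using X nX Y by linarith
  qed
  have f1: "1 \<le> (fact ?N :: real)" by (rule fact_ge_1)
  have M1: "1 * 1 \<le> M" unfolding M_def by (intro mult_mono one_le_power E f1) auto
  then show "1 \<le> M" by simp
  have LM: "?L M \<le> 124 * (real ?N * Y)"
  proof -
    have "(fact ?N :: real) \<le> real ?N ^ ?N"
      using fact_le_power[of ?N] by (metis of_nat_power)
    then have "?L (fact ?N) \<le> ?L (real ?N ^ ?N)"
      using f1 N1 by (subst log_le_cancel_iff) auto
    also have "\<dots> = real ?N * ?L (real ?N)" using N1 by (subst log_nat_power) auto
    also have "\<dots> \<le> real ?N * (4 * Y)" by (intro mult_left_mono LN) simp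
    finally have 1: "?L (fact ?N) \<le> 4 * (real ?N * Y)" by simp
    have "?L M = ?L (fact ?N) + real ?N * ?L (1 + \<Lambda> * \<Gamma> ^ ?D)"
    proof -
      have e0: "0 < 1 + \<Lambda> * \<Gamma> ^ ?D" using E by linarith
      have "?L M = ?L (fact ?N) + ?L ((1 + \<Lambda> * \<Gamma> ^ ?D) ^ ?N)"
        unfolding M_def using f1 e0 by (intro log_mult_pos zero_less_power) auto
      then show ?thesis using log_nat_power[OF less_imp_le[OF e0], of 2 ?N] by simp
    qed
    moreover have "real ?N * ?L (1 + \<Lambda> * \<Gamma> ^ ?D) \<le> real ?N * (120 * Y)"
      by (intro mult_left_mono LE) simp
    ultimately show ?thesis using 1 by linarith
  qed
  have "1 * 1 * 1 * 1 \<le> K"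
    unfolding K_def using dr \<Lambda> H by (intro mult_mono one_le_power) auto
  then show K1: "1 \<le> K" by simp
  have LK: "?L K \<le> 22 * Y"
  proof -
    have "?L K = 2 * real n * ?L (2 * real d + 1) + 2 * real d * (1 + ?L (real d)) + ?L \<Lambda> + 2 * real d * ?L H"
      unfolding K_def using dr \<Lambda> H by (simp add: log_mult log_nat_power ld1 l8 distrib_left)
    also have "2 * real n * ?L (2 * real d + 1) \<le> 2 * real n * (2 + ?L (real d))"
    proof (rule mult_left_mono)
      have "?L (2 * real d + 1) \<le> ?L (4 * real d)" using dr by (subst log_le_cancel_iff) auto
      then show "?L (2 * real d + 1) \<le> 2 + ?L (real d)" by (simp add: ld1 l8)
    qed simp
    also have "2 * real d * (1 + ?L (real d)) \<le> 2 * real d * (2 * X)"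
      using X by (intro mult_left_mono) auto
    also have "2 * real d * ?L H \<le> 2 * real d * X" using X by (intro mult_left_mono) auto
    finally have "?L K \<le> 4 * real n + 2 * (real n * ?L (real d)) + 6 * (real d * X) + ?L \<Lambda>"
      by (simp add: algebra_simps)
    moreover have "real d * X \<le> real n * real d * X"
      using mult_right_mono[OF nd(3), of X] X by simp
    ultimately show ?thesis using L\<Lambda> X nX Y ndX by linarith
  qed
  define Z where "Z = real ?N * Y"
  have "1 * Y \<le> Z" unfolding Z_def using N1 Y by (intro mult_right_mono) auto
  then have Z: "Y \<le> Z" "1 \<le> Z" using Y by linarith+
  have "0 < M" using M1 by simp
  have "?L (2 * (4 * H * K * M) ^ n) = 1 + real n * (2 + ?L H + ?L K + ?L M)"
    using H K1 \<open>0 < M\<close> by (simp add: log_mult log_nat_power l8)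
  \<comment> \<open>149 = 2 + 1 + 22 + 124, for the constant 4, \<open>H\<close>, \<open>K\<close>
    and \<open>M\<close>; the leading factor 2 of the count raises this to 150.\<close>
  also have "\<dots> \<le> 1 + real n * (149 * Z)"
    using X(3) nX(2) Y(1) Z LK LM[folded Z_def] by (intro add_left_mono mult_left_mono) linarith+
  also have "\<dots> \<le> 150 * (real n * Z)"
    using mult_mono[OF nr Z(2)] by (simp add: mult_ac)
  also have "real n * Z = real n ^ 3 * ((2 * real d + 3) ^ n * real d) * X"
    by (simp add: Z_def Y_def power3_eq_cube)
  \<comment> \<open>The only place where the exponents of the theorem appear:
    \<open>(2 * d + 3) ^ n\<close> is relaxed to 2^(24n) d^(12n).\<close>
  also have "150 * \<dots> \<le> 150 * (real n ^ 3 * (2 ^ (24 * n) * real d ^ (12 * n + 1)) * X)"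
  proof -
    have "(2 * real d + 3) ^ n \<le> (2 ^ 24 * real d ^ 12) ^ n"
    proof (rule power_mono)
      have "2 * real d + 3 \<le> 2 ^ 24 * real d" using dr by simp
      also have "\<dots> \<le> 2 ^ 24 * real d ^ 12" using dr by (intro mult_left_mono self_le_power) auto
      finally show "2 * real d + 3 \<le> 2 ^ 24 * real d ^ 12" .
    qed auto
    also have "\<dots> = 2 ^ (24 * n) * real d ^ (12 * n)"
      by (simp only: power_mult_distrib power_mult)
    finally have "(2 * real d + 3) ^ n * real d \<le> 2 ^ (24 * n) * real d ^ (12 * n) * real d"
      by (intro mult_right_mono) auto
    then have "(2 * real d + 3) ^ n * real d \<le> 2 ^ (24 * n) * real d ^ (12 * n + 1)"
      by (simp add: mult_ac)
    then show ?thesis using X by (intro mult_left_mono mult_right_mono) auto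
  qed
  finally have "?L (2 * (4 * H * K * M) ^ n) \<le> 150 * (real n ^ 3 * 2 ^ (24 * n) * real d ^ (12 * n + 1) * X)"
    by (simp only: mult.assoc)
  moreover have "0 < 2 * (4 * H * K * M) ^ n" using H K1 \<open>0 < M\<close> by simp
  ultimately show "2 * (4 * H * K * M) ^ n \<le> 2 powr (150 * (real n ^ 3 * 2 ^ (24 * n) * real d ^ (12 * n + 1) * X))"
    by (subst (asm) log_le_iff) auto
qed

lemma finite_corners: "finite (corners J)"
proof (rule finite_subset)
  let ?A = "set (lower J) \<union> (\<lambda>t. t + width J) ` set (lower J)"
  show "corners J \<subseteq> {c. set c \<subseteq> ?A \<and> length c = length (lower J)}"
    by (fastforce simp: corners_def in_set_conv_nth)
  show "finite {c. set c \<subseteq> ?A \<and> length c = length (lower J)}"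
    by (rule finite_lists_length_eq) simp
qed

lemma
  shows coeff_le_input_height: "\<alpha> \<in> keys f \<Longrightarrow> \<bar>real_of_int (lookup f \<alpha>)\<bar> \<le> input_height f I"
    and corner_le_input_height: "c \<in> corners I \<Longrightarrow> i < length c \<Longrightarrow> \<bar>c ! i\<bar> \<le> input_height f I"
proof -
  let ?A = "{\<bar>real_of_int (lookup f \<alpha>)\<bar> | \<alpha>. \<alpha> \<in> keys f}"
  let ?B = "{\<bar>c ! i\<bar> | c i. c \<in> corners I \<and> i < length c}"
  have "?A = (\<lambda>\<alpha>. \<bar>real_of_int (lookup f \<alpha>)\<bar>) ` keys f" by auto
  then have A: "finite ?A" by simp
  have "?B = (\<Union>c\<in>corners I. (\<lambda>i. \<bar>c ! i\<bar>) ` {..<length c})" by auto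
  then have B: "finite ?B" using finite_corners by simp
  show "\<alpha> \<in> keys f \<Longrightarrow> \<bar>real_of_int (lookup f \<alpha>)\<bar> \<le> input_height f I"
    unfolding input_height_def using A B by (intro Max_ge) auto
  show "c \<in> corners I \<Longrightarrow> i < length c \<Longrightarrow> \<bar>c ! i\<bar> \<le> input_height f I"
    unfolding input_height_def using A B by (intro Max_ge) auto
qed

text \<open>At the midpoint of a cube of width at most 2 that fails both tests, 1/M \<le> G \<le>
  width * K. Hence 1/(K M) is a width below which no cube is split, and the potential argument
  applies.\<close>

lemma pv_size_bound:
  fixes f :: "int mpoly"
  assumes f: "vars f \<subseteq> {..<n}" "total_degree f = d" "1 \<le> d"
    and sm: "smooth_zero_set n (real_poly f)"
    and I: "is_cube n I" "\<forall>c\<in>corners I. set c \<subseteq> \<int>"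
  defines "H \<equiv> input_height f I"
  shows "pv_terminates n (real_poly f) I"
    and "pv_output n (real_poly f) I P \<Longrightarrow> finite P \<and>
      real (card P) \<le> 2 powr (150 * (real n ^ 3 * 2 ^ (24 * n) * real d ^ (12 * n + 1) *
        (real d + log 2 H + real n * log 2 (real d))))"
proof -
  let ?F = "real_poly f" and ?G = "grad_energy n (real_poly f)"
  let ?a = "\<lambda>i. lower I ! i" and ?b = "\<lambda>i. lower I ! i + width I"
  have lI: "length (lower I) = n" and wI: "0 < width I" using I by (simp_all add: is_cube_def)
  \<comment> \<open>Positive degree yields a nonconstant monomial with a nonzero integer
    coefficient; this gives both \<open>1 \<le> n\<close> and \<open>1 \<le> H\<close>.\<close>
  have "\<not> (\<forall>\<alpha>\<in>keys f. mdeg \<alpha> \<le> 0)"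
    using f(2,3) total_degree_le_iff[of f 0] by simp
  then obtain \<alpha> where \<alpha>: "\<alpha> \<in> keys f" "mdeg \<alpha> \<noteq> 0" by auto
  then have "keys \<alpha> \<noteq> {}" by (auto simp: mdeg_def)
  then have n: "1 \<le> n" using f(1) \<alpha>(1) by (fastforce simp: vars_def)
  have "\<bar>lookup f \<alpha>\<bar> \<ge> 1" using \<alpha>(1) by (simp add: in_keys_iff)
  then have "\<bar>real_of_int (lookup f \<alpha>)\<bar> \<ge> 1" by linarith
  then have H: "1 \<le> H" using coeff_le_input_height[OF \<alpha>(1), of I] by (simp add: H_def)
  have ca: "lower I \<in> corners I" by (simp add: corners_def)
  have cb: "map (\<lambda>t. t + width I) (lower I) \<in> corners I" by (simp add: corners_def)
  have ab: "?a i \<in> \<int> \<and> ?b i \<in> \<int> \<and> ?a i \<le> ?b i \<and> \<bar>?a i\<bar> \<le> H \<and> \<bar>?b i\<bar> \<le> H" if i: "i < n" for i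
  proof -
    have "?a i \<in> set (lower I)" "?b i \<in> set (map (\<lambda>t. t + width I) (lower I))"
      using i lI by auto
    then have "?a i \<in> \<int>" "?b i \<in> \<int>" using I(2) ca cb by blast+
    moreover have "\<bar>?a i\<bar> \<le> H" "\<bar>?b i\<bar> \<le> H"
      using corner_le_input_height[OF ca, of i f] corner_le_input_height[OF cb, of i f] i lI
      by (simp_all add: H_def)
    ultimately show ?thesis using wI by simp
  qed
  \<comment> \<open>Integral corners make the width a positive integer, so \<open>w0 \<le> 1\<close>
    does not exceed the width of \<open>I\<close>.\<close>
  have W: "1 \<le> width I" "width I \<le> 2 * H"
  proof -
    have 0: "0 < n" using n by simp
    have "width I = ?b 0 - ?a 0" by simp
    then have "width I \<in> \<int>" using ab[OF 0] by (metis Ints_diff)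
    then show "1 \<le> width I" using wI by (auto elim!: Ints_cases)
    show "width I \<le> 2 * H" using ab[OF 0] by linarith
  qed
  define \<Lambda> where "\<Lambda> = (1 + real n * (real d)\<^sup>2) * ((real d + 1) ^ n * H)\<^sup>2"
  define \<Gamma> where "\<Gamma> = 2 * H + H\<^sup>2 + (1 + H)\<^sup>2 * (real (2 * d) * \<Lambda>)"
  define M where "M = fact ((2 * d + 3) ^ n) * (1 + \<Lambda> * \<Gamma> ^ (n * (2 * d + 2) + 2 * d)) ^ ((2 * d + 3) ^ n)"
  define K where "K = (2 * real d + 1) ^ (2 * n) * (2 * real d) ^ (2 * d) * \<Lambda> * H ^ (2 * d)"
  note size = log_size_bound[OF n f(3) H, folded \<Lambda>_def, folded \<Gamma>_def, folded M_def K_def]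
  have l1F: "l1_norm ?F \<le> (real d + 1) ^ n * H"
    using f H coeff_le_input_height[of _ f I]
    by (intro l1_norm_le_card) (auto simp: lookup_real_poly H_def)
  then have l1F2: "(1 + real n * (real d)\<^sup>2) * (l1_norm ?F)\<^sup>2 \<le> \<Lambda>"
    unfolding \<Lambda>_def by (intro mult_left_mono power_mono) auto
  have pos: "0 < mpeval ?G x" for x
  proof -
    have nn: "0 \<le> (\<Sum>i<n. (mpeval (pdiff i ?F) x)\<^sup>2)" by (simp add: sum_nonneg)
    have "mpeval ?G x \<noteq> 0"
    proof
      assume "mpeval ?G x = 0"
      then have "(mpeval ?F x)\<^sup>2 = 0" "(\<Sum>i<n. (mpeval (pdiff i ?F) x)\<^sup>2) = 0"
        unfolding mpeval_grad_energy using nn zero_le_power2[of "mpeval ?F x"] by linarith+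
      then have "mpeval ?F x = 0" "\<forall>i<n. mpeval (pdiff i ?F) x = 0"
        by (simp_all add: sum_nonneg_eq_0_iff)
      then show False using sm unfolding smooth_zero_set_def by blast
    qed
    moreover have "0 \<le> mpeval ?G x" unfolding mpeval_grad_energy using nn by simp
    ultimately show ?thesis by linarith
  qed
  have low: "1 / M \<le> mpeval ?G y" if "\<And>i. i < n \<Longrightarrow> ?a i \<le> y i \<and> y i \<le> ?b i" for y
    unfolding M_def \<Gamma>_def
  proof (rule positive_on_box_lower_bound[where a = ?a and b = ?b])
    show "total_degree ?G \<le> 2 * d" using total_degree_grad_energy_le[of n ?F] f by simp
    show "l1_norm ?G \<le> \<Lambda>"
      using l1_norm_grad_energy_le[of ?F d n] f l1F2 by simp
    show "vars ?G \<subseteq> {..<n}" using f by (intro vars_grad_energy_subset) simp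
    show "?a i \<in> \<int> \<and> ?b i \<in> \<int> \<and> ?a i \<le> ?b i \<and> \<bar>?a i\<bar> \<le> H \<and> \<bar>?b i\<bar> \<le> H" if "i < n" for i
      by (rule ab[OF that])
  qed (use H pos that int_coeffs_grad_energy[OF int_coeffs_real_poly] in simp_all)
  define w0 where "w0 = 1 / (K * M)"
  have KM: "1 \<le> K * M" using mult_mono[OF size(2) size(1)] size by simp
  have w0: "0 < w0" "w0 \<le> 1" using KM by (simp_all add: w0_def)
  have big: "w0 \<le> width J" if J: "subcube_of I J" "\<not> C0 ?F J" "\<not> C1 n ?F J" for J
  \<comment> \<open>The radius estimate for the centered form presupposes half-width at most 1;
    wider cubes exceed \<open>w0 \<le> 1\<close> trivially.\<close>
  proof (cases "width J \<le> 2")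
    case False
    then show ?thesis using w0 by linarith
  next
    case True
    let ?m = "\<lambda>i. cube_midpoint J ! i"
    have lJ: "length (lower J) = n" and wJ: "0 < width J" using J lI by (simp_all add: subcube_of_def)
    have m: "?a i \<le> ?m i \<and> ?m i \<le> ?b i" if "i < n" for i
    proof -
      have "?m i = lower J ! i + width J / 2" using lJ that by (simp add: cube_midpoint_def)
      moreover have "?a i \<le> lower J ! i" "lower J ! i + width J \<le> ?b i"
        using J(1) that lI by (auto simp: subcube_of_def)
      ultimately show ?thesis using wJ by linarith
    qed
    have "\<bar>?m i\<bar> \<le> H" if "i < n" for i
      using m[OF that] ab[OF that] by linarith
    then have "mpeval ?G ?m \<le> width J * ((2 * real d + 1) ^ (2 * n) * (2 * real d) ^ (2 * d) *
        ((1 + real n * (real d)\<^sup>2) * (l1_norm ?F)\<^sup>2) * H ^ (2 * d))"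
      using f H J lJ wJ True by (intro nonterminal_cube_energy_le) auto
    also have "\<dots> \<le> width J * K"
      unfolding K_def using l1F2 wJ H by (intro mult_left_mono mult_right_mono) auto
    finally have "1 / M \<le> width J * K" using low[of ?m] m by force
    then have "1 / M / K \<le> width J" using size(2) by (subst pos_divide_le_eq) auto
    then show ?thesis by (simp add: w0_def mult.commute)
  qed
  have w0W: "w0 \<le> width I" using w0 W by linarith
  show "pv_terminates n ?F I" by (rule pv_bounds(1)[OF I(1) n w0(1) w0W big])
  show "finite P \<and> real (card P) \<le> 2 powr (150 * (real n ^ 3 * 2 ^ (24 * n) * real d ^ (12 * n + 1) *
      (real d + log 2 H + real n * log 2 (real d))))" if "pv_output n ?F I P"
  proof -
    have P: "finite P" "real (card P) \<le> 2 * (2 * width I / w0) ^ n"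
      using pv_bounds(2)[OF I(1) n w0(1) w0W big that] by auto
    have "2 * width I / w0 = 2 * width I * (K * M)" by (simp add: w0_def)
    also have "\<dots> \<le> (2 * (2 * H)) * (K * M)"
      using W KM by (intro mult_right_mono mult_left_mono) auto
    also have "\<dots> = 4 * H * K * M" by simp
    finally have "(2 * width I / w0) ^ n \<le> (4 * H * K * M) ^ n"
      using W w0 by (intro power_mono) auto
    with P(2) size(3) have "real (card P) \<le> 2 powr (150 * (real n ^ 3 * 2 ^ (24 * n) * real d ^ (12 * n + 1) *
      (real d + log 2 H + real n * log 2 (real d))))" by linarith
    with P(1) show ?thesis by blast
  qed
qed

theorem theorem24:
  shows "\<exists>C::real. C > 0 \<and>
    (\<forall>(n::nat) (d::nat) (f :: int mpoly) (I :: cube) (H::real).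
       vars f \<subseteq> {..<n} \<longrightarrow> total_degree f = d \<longrightarrow> d \<ge> 1 \<longrightarrow>
       smooth_zero_set n (real_poly f) \<longrightarrow>
       is_cube n I \<longrightarrow> (\<forall>c\<in>corners I. set c \<subseteq> \<int>) \<longrightarrow>
       H = input_height f I \<longrightarrow>
         pv_terminates n (real_poly f) I \<and>
         (\<forall>P. pv_output n (real_poly f) I P \<longrightarrow>
            finite P \<and>
            real (card P) \<le> 2 powr (C * (real n ^ 3 * 2 ^ (24 * n) * real d ^ (12 * n + 1) *
              (real d + log 2 H + real n * log 2 (real d))))))"
\<comment> \<open>150 is the constant accumulated in \<open>log_size_bound\<close>.\<close>
proof (intro exI[of _ 150] conjI allI impI)
  show "(0::real) < 150" by simp
qed (use pv_size_bound in blast)+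

end
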